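(* Let $v$ be a traversing vector field on a compact connected smooth manifold $X$ with boundary, and let $f:X\to\mathbb R$ be its Lyapunov function. Then the partial order $\succ_v$ on $\partial X$, together with the restriction $f^\partial:\partial X\to\mathbb R$ of the Lyapunov function $f:X\to\mathbb R$, allows for a reconstruction of the topological type of the pair $(X,\mathcal F(v))$.
   Context: A smooth vector field $v$ on $X$ is traversing if each $v$-trajectory is either a closed interval with both ends in $\partial X$ or a singleton in $\partial X$. A Lyapunov function for $v$ is a smooth $f:X\to\mathbb R$ with $df(v)>0$ on $X$. $\mathcal F(v)$ is the oriented $1$-dimensional foliation of $X$ whose leaves are the $v$-trajectories. For $x,y\in\partial X$ we write $y\succ_vx$ if $x$ and $y$ lie on the same $v$-trajectory $\gamma\subset X$ and, moving from $x$ in the direction of $v$ along $\gamma$, one can reach $y$; this defines a partial order on the set $\partial X$. *)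

theory Defs
  imports "HOL-Analysis.Analysis"
begin

section \<open>Smooth maps between subsets of Euclidean spaces\<close>

text \<open>Only used for open \<open>U\<close>, where it says that \<open>f\<close> is of class \<open>C\<^sup>k\<close>: all iterated
  directional derivatives up to order \<open>k\<close> exist and are continuous.\<close>

primrec Ck_on :: "nat \<Rightarrow> 'e::euclidean_space set \<Rightarrow> ('e \<Rightarrow> 'f::euclidean_space) \<Rightarrow> bool" where
  "Ck_on 0 U f \<longleftrightarrow> continuous_on U f"
| "Ck_on (Suc k) U f \<longleftrightarrow>
     (\<forall>p\<in>U. f differentiable (at p)) \<and> (\<forall>w. Ck_on k U (\<lambda>p. frechet_derivative f (at p) w))"

text \<open>On a set that need not be open, smoothness means local extendability to a smooth map on an
  open set; this is the usual notion at boundary points of the half-space.\<close>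

definition smooth_on :: "'e::euclidean_space set \<Rightarrow> ('e \<Rightarrow> 'f::euclidean_space) \<Rightarrow> bool" where
  "smooth_on S f \<longleftrightarrow>
     (\<forall>p\<in>S. \<exists>U g. open U \<and> p \<in> U \<and> (\<forall>k. Ck_on k U g) \<and> (\<forall>q\<in>S \<inter> U. g q = f q))"


section \<open>Smooth manifolds with boundary\<close>

text \<open>The model half-space; the dimension of the manifold is \<open>DIM('e)\<close>, so at least 1. (A nonempty
  0-dimensional manifold has empty boundary, hence carries no traversing vector field.)\<close>

definition half_space :: "'e::euclidean_space set" where
  "half_space = {p. 0 \<le> p \<bullet> (SOME b. b \<in> Basis)}"

text \<open>A chart is its domain together with its coordinate map; values of the coordinate map outside
  the domain are irrelevant.\<close>

type_synonym ('a, 'e) chart = "'a set \<times> ('a \<Rightarrow> 'e)"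

abbreviation cdom :: "('a, 'e) chart \<Rightarrow> 'a set" where "cdom \<equiv> fst"
abbreviation coord :: "('a, 'e) chart \<Rightarrow> 'a \<Rightarrow> 'e" where "coord \<equiv> snd"

definition cinv :: "('a, 'e) chart \<Rightarrow> 'e \<Rightarrow> 'a" where
  "cinv c = inv_into (cdom c) (coord c)"

definition chart_on :: "'a topology \<Rightarrow> ('a, 'e::euclidean_space) chart \<Rightarrow> bool" where
  "chart_on X c \<longleftrightarrow>
     openin X (cdom c) \<and>
     openin (top_of_set half_space) (coord c ` cdom c) \<and>
     homeomorphic_map (subtopology X (cdom c)) (top_of_set (coord c ` cdom c)) (coord c)"

text \<open>The smooth structure is given by an atlas, which is not required to be maximal.\<close>

definition smooth_manifold_with_boundary ::
    "'a topology \<Rightarrow> ('a, 'e::euclidean_space) chart set \<Rightarrow> bool" where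
  "smooth_manifold_with_boundary X A \<longleftrightarrow>
     Hausdorff_space X \<and> second_countable X \<and>
     (\<forall>c\<in>A. chart_on X c) \<and> (\<Union>c\<in>A. cdom c) = topspace X \<and>
     (\<forall>c\<in>A. \<forall>d\<in>A. smooth_on (coord c ` (cdom c \<inter> cdom d)) (coord d \<circ> cinv c))"

definition mboundary :: "('a, 'e::euclidean_space) chart set \<Rightarrow> 'a set" where
  "mboundary A = {x. \<exists>c\<in>A. x \<in> cdom c \<and> coord c x \<in> frontier half_space}"

definition smooth_fun :: "('a, 'e::euclidean_space) chart set \<Rightarrow> ('a \<Rightarrow> real) \<Rightarrow> bool" where
  "smooth_fun A f \<longleftrightarrow> (\<forall>c\<in>A. smooth_on (coord c ` cdom c) (f \<circ> cinv c))"


section \<open>Vector fields, trajectories and Lyapunov functions\<close>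

text \<open>A vector field assigns to each chart \<open>c\<close> and each point \<open>x\<close> of its domain the components
  \<open>v c x\<close> of the tangent vector at \<open>x\<close> in that chart; these are subject to the usual transformation
  law under change of charts.\<close>

type_synonym ('a, 'e) vfield = "('a, 'e) chart \<Rightarrow> 'a \<Rightarrow> 'e"

definition smooth_vector_field ::
    "('a, 'e::euclidean_space) chart set \<Rightarrow> ('a, 'e) vfield \<Rightarrow> bool" where
  "smooth_vector_field A v \<longleftrightarrow>
     (\<forall>c\<in>A. smooth_on (coord c ` cdom c) (v c \<circ> cinv c)) \<and>
     (\<forall>c\<in>A. \<forall>d\<in>A. \<forall>x\<in>cdom c \<inter> cdom d.
        v d x = frechet_derivative (coord d \<circ> cinv c)
                  (at (coord c x) within coord c ` (cdom c \<inter> cdom d)) (v c x))"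

text \<open>Integral curves inside \<open>X\<close>, defined on an arbitrary nonempty interval of reals, possibly a
  single point (at a boundary point the field may leave \<open>X\<close> in both time directions).\<close>

definition integral_curve ::
    "'a topology \<Rightarrow> ('a, 'e::euclidean_space) chart set \<Rightarrow> ('a, 'e) vfield \<Rightarrow>
     real set \<Rightarrow> (real \<Rightarrow> 'a) \<Rightarrow> bool" where
  "integral_curve X A v I \<gamma> \<longleftrightarrow>
     is_interval I \<and> I \<noteq> {} \<and> continuous_map (top_of_set I) X \<gamma> \<and>
     (\<forall>t\<in>I. \<forall>c\<in>A. \<gamma> t \<in> cdom c \<longrightarrow>
        ((coord c \<circ> \<gamma>) has_vector_derivative v c (\<gamma> t)) (at t within I))"

definition maximal_integral_curve ::
    "'a topology \<Rightarrow> ('a, 'e::euclidean_space) chart set \<Rightarrow> ('a, 'e) vfield \<Rightarrow>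
     real set \<Rightarrow> (real \<Rightarrow> 'a) \<Rightarrow> bool" where
  "maximal_integral_curve X A v I \<gamma> \<longleftrightarrow>
     integral_curve X A v I \<gamma> \<and>
     (\<forall>J \<delta>. integral_curve X A v J \<delta> \<and> I \<subseteq> J \<and> (\<forall>t\<in>I. \<delta> t = \<gamma> t) \<longrightarrow> J = I)"

text \<open>The set of \<open>v\<close>-trajectories, i.e. of leaves of the foliation \<open>\<F>(v)\<close>.\<close>

definition trajectories ::
    "'a topology \<Rightarrow> ('a, 'e::euclidean_space) chart set \<Rightarrow> ('a, 'e) vfield \<Rightarrow> 'a set set" where
  "trajectories X A v = {\<gamma> ` I |I \<gamma>. maximal_integral_curve X A v I \<gamma>}"

definition traversing ::
    "'a topology \<Rightarrow> ('a, 'e::euclidean_space) chart set \<Rightarrow> ('a, 'e) vfield \<Rightarrow> bool" where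
  "traversing X A v \<longleftrightarrow>
     smooth_vector_field A v \<and>
     (\<forall>L\<in>trajectories X A v.
        (\<exists>g. homeomorphic_map (top_of_set {0..1::real}) (subtopology X L) g \<and>
             g 0 \<in> mboundary A \<and> g 1 \<in> mboundary A) \<or>
        (\<exists>x\<in>mboundary A. L = {x}))"

definition lyapunov ::
    "('a, 'e::euclidean_space) chart set \<Rightarrow> ('a, 'e) vfield \<Rightarrow> ('a \<Rightarrow> real) \<Rightarrow> bool" where
  "lyapunov A v f \<longleftrightarrow>
     smooth_fun A f \<and>
     (\<forall>c\<in>A. \<forall>x\<in>cdom c.
        0 < frechet_derivative (f \<circ> cinv c) (at (coord c x) within coord c ` cdom c) (v c x))"

text \<open>\<open>(x, y) \<in> trajectory_order X A v\<close> says that \<open>x\<close> and \<open>y\<close> lie on one trajectory and that \<open>y\<close> is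
  reached from \<open>x\<close> by moving along it in the direction of \<open>v\<close>. This encodes the orientation of the
  leaves; its restriction to the boundary is the (reflexive) order \<open>y \<succ>\<^sub>v x\<close>.\<close>

definition trajectory_order ::
    "'a topology \<Rightarrow> ('a, 'e::euclidean_space) chart set \<Rightarrow> ('a, 'e) vfield \<Rightarrow> 'a rel" where
  "trajectory_order X A v =
     {(\<gamma> s, \<gamma> t) |I \<gamma> s t. maximal_integral_curve X A v I \<gamma> \<and> s \<in> I \<and> t \<in> I \<and> s \<le> t}"

definition boundary_order ::
    "'a topology \<Rightarrow> ('a, 'e::euclidean_space) chart set \<Rightarrow> ('a, 'e) vfield \<Rightarrow> 'a rel" where
  "boundary_order X A v = trajectory_order X A v \<inter> mboundary A \<times> mboundary A"

text \<open>Isomorphism of the boundary data \<open>(\<partial>X, \<succ>\<^sub>v, f\<^sup>\<partial>)\<close>, where \<open>\<partial>X\<close> carries the subspace topology.\<close>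

definition boundary_data_iso ::
    "'a topology \<Rightarrow> ('a, 'e::euclidean_space) chart set \<Rightarrow> ('a, 'e) vfield \<Rightarrow> ('a \<Rightarrow> real) \<Rightarrow>
     'b topology \<Rightarrow> ('b, 'd::euclidean_space) chart set \<Rightarrow> ('b, 'd) vfield \<Rightarrow> ('b \<Rightarrow> real) \<Rightarrow>
     ('a \<Rightarrow> 'b) \<Rightarrow> bool" where
  "boundary_data_iso X A v f Y B w g \<phi> \<longleftrightarrow>
     homeomorphic_map (subtopology X (mboundary A)) (subtopology Y (mboundary B)) \<phi> \<and>
     (\<forall>x\<in>mboundary A. \<forall>y\<in>mboundary A.
        (x, y) \<in> boundary_order X A v \<longleftrightarrow> (\<phi> x, \<phi> y) \<in> boundary_order Y B w) \<and>
     (\<forall>x\<in>mboundary A. g (\<phi> x) = f x)"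

text \<open>Homeomorphism of the pairs \<open>(X, \<F>(v))\<close> and \<open>(Y, \<F>(w))\<close>: leaves correspond to leaves, and the
  orientations of the leaves agree.\<close>

definition foliated_homeomorphism ::
    "'a topology \<Rightarrow> ('a, 'e::euclidean_space) chart set \<Rightarrow> ('a, 'e) vfield \<Rightarrow>
     'b topology \<Rightarrow> ('b, 'd::euclidean_space) chart set \<Rightarrow> ('b, 'd) vfield \<Rightarrow>
     ('a \<Rightarrow> 'b) \<Rightarrow> bool" where
  "foliated_homeomorphism X A v Y B w \<Phi> \<longleftrightarrow>
     homeomorphic_map X Y \<Phi> \<and>
     (`) \<Phi> ` trajectories X A v = trajectories Y B w \<and>
     (\<forall>x\<in>topspace X. \<forall>y\<in>topspace X.
        (x, y) \<in> trajectory_order X A v \<longleftrightarrow> (\<Phi> x, \<Phi> y) \<in> trajectory_order Y B w)"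

end

theory Submission
  imports Defs "HOL-Complex_Analysis.Great_Picard"
begin

text \<open>Every point \<open>x\<close> of \<open>X\<close> lies on a unique trajectory; both ends of it are in the boundary and \<open>f\<close> is
  strictly increasing along it. So the boundary data determine a bijection: \<open>x\<close> is sent to the point
  of \<open>Y\<close> at height \<open>f x\<close> on the trajectory through \<open>\<phi> a\<close>, where \<open>a\<close> is any boundary point on the
  trajectory of \<open>x\<close>. Its continuity reduces, via the closed graph property, to the fact that lying on
  one trajectory is a closed relation. For that, limits of short integral curves are integral curves by
  Arzela--Ascoli, and the life times of all integral curves are bounded, so that the relation is a finite
  composition of closed relations. The existence theorem for differential equations is never needed: a
  trajectory may a priori be a point, and that trajectories end in the boundary is part of the
  hypothesis on \<open>v\<close>.\<close>

section \<open>Differential equations in Euclidean space\<close>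

text \<open>The obstacle is that leaves do not vary continuously. For the vertical field on a plane
  annulus, the lines close to a tangent of the inner circle are cut in two on one side of it: a
  limit of leaves may be a proper piece of a leaf, and the first boundary point of the leaf through
  \<open>x\<close> jumps with \<open>x\<close>. So no continuous choice of \<open>a\<close> can be
  expected. The map is therefore handled through its graph \<open>corresponds\<close>, which
  quantifies over all boundary points of the leaf. It is the composition of "same leaf" in
  \<open>X\<close>, the graph of \<open>\<phi>\<close> and "same leaf" in \<open>Y\<close>, cut down
  by the closed condition \<open>g y = f x\<close>; compactness keeps such compositions closed.

  The order on the boundary tells which boundary points share a leaf; position and direction on a
  leaf are read off from the heights. Running the construction with the inverse of
  \<open>\<phi>\<close> yields the converse relation, whence bijectivity.

  Uniqueness of solutions is essential: it makes "same leaf" transitive and lets a leaf be recovered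
  from any of its points.\<close>

lemma lipschitz_ode_unique:
  fixes F :: "'e::euclidean_space \<Rightarrow> 'e"
  assumes lip: "K-lipschitz_on P F" and "0 \<le> t"
    and \<eta>: "\<And>s. s \<in> {0..t} \<Longrightarrow> \<eta> s \<in> P"
      "\<And>s. s \<in> {0..t} \<Longrightarrow> (\<eta> has_vector_derivative F (\<eta> s)) (at s within {0..t})"
    and \<theta>: "\<And>s. s \<in> {0..t} \<Longrightarrow> \<theta> s \<in> P"
      "\<And>s. s \<in> {0..t} \<Longrightarrow> (\<theta> has_vector_derivative F (\<theta> s)) (at s within {0..t})"
    and "\<eta> 0 = \<theta> 0"
  shows "\<eta> t = \<theta> t"
proof -
  \<comment> \<open>Gronwall's argument: the squared distance grows at relative rate at most
    \<open>2 * K\<close>, so the exponential weight makes \<open>h\<close> nonincreasing; it is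
    nonnegative and starts at 0.\<close>
  define h where "h s = exp (- 2 * K * s) * ((\<eta> s - \<theta> s) \<bullet> (\<eta> s - \<theta> s))" for s
  have "h t \<le> h 0"
  proof (rule DERIV_nonpos_imp_decreasing_open[OF \<open>0 \<le> t\<close>])
    fix s :: real assume s: "0 < s" "s < t"
    define d where "d = \<eta> s - \<theta> s"
    define e where "e = F (\<eta> s) - F (\<theta> s)"
    have at: "at s within {0..t} = at s"
      using s by (intro at_within_interior) auto
    have "(\<eta> has_vector_derivative F (\<eta> s)) (at s)" "(\<theta> has_vector_derivative F (\<theta> s)) (at s)"
      using \<eta>(2)[of s] \<theta>(2)[of s] s at by auto
    then have "((\<lambda>s. \<eta> s - \<theta> s) has_vector_derivative e) (at s)"
      unfolding e_def by (rule has_vector_derivative_diff)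
    then have "((\<lambda>s. \<eta> s - \<theta> s) has_derivative (\<lambda>x. x *\<^sub>R e)) (at s)"
      by (simp add: has_vector_derivative_def)
    from has_derivative_inner[OF this this]
    have "((\<lambda>s. (\<eta> s - \<theta> s) \<bullet> (\<eta> s - \<theta> s)) has_real_derivative (2 * (d \<bullet> e))) (at s)"
      unfolding has_field_derivative_def
      by (rule has_derivative_eq_rhs) (simp add: fun_eq_iff d_def e_def inner_commute)
    moreover have "((\<lambda>s. exp (- 2 * K * s)) has_real_derivative exp (- 2 * K * s) * (- 2 * K)) (at s)"
      by (auto intro!: derivative_eq_intros)
    ultimately have "(h has_real_derivative exp (- 2 * K * s) * (2 * (d \<bullet> e) - 2 * K * (d \<bullet> d))) (at s)"
      unfolding h_def by (auto dest: DERIV_mult simp: d_def right_diff_distrib mult.commute mult.left_commute)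
    moreover have "d \<bullet> e \<le> K * (d \<bullet> d)"
    proof -
      have "d \<bullet> e \<le> norm d * norm e" by (rule norm_cauchy_schwarz)
      also have "\<dots> \<le> norm d * (K * norm d)"
        using lipschitz_onD[OF lip \<eta>(1)[of s] \<theta>(1)[of s]] s
        by (intro mult_left_mono) (auto simp: d_def e_def dist_norm)
      finally show ?thesis by (simp add: dot_square_norm power2_eq_square algebra_simps)
    qed
    ultimately show "\<exists>y. (h has_real_derivative y) (at s) \<and> y \<le> 0"
      by (intro exI[of _ "exp (- 2 * K * s) * (2 * (d \<bullet> e) - 2 * K * (d \<bullet> d))"] conjI)
        (auto simp: mult_le_0_iff)
  next
    have "continuous_on {0..t} \<eta>" "continuous_on {0..t} \<theta>"
      using continuous_on_vector_derivative[OF \<eta>(2)] continuous_on_vector_derivative[OF \<theta>(2)]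
      by simp_all
    then show "continuous_on {0..t} h"
      unfolding h_def by (intro continuous_intros)
  qed
  then have "(\<eta> t - \<theta> t) \<bullet> (\<eta> t - \<theta> t) \<le> 0"
    using \<open>\<eta> 0 = \<theta> 0\<close> by (simp add: h_def mult_le_0_iff)
  then show ?thesis
    by (meson inner_gt_zero_iff not_less right_minus_eq)
qed

text \<open>Solutions for time \<open>t\<close> are rescaled to the unit interval, so that solutions with different
  life times can be compared on one domain.\<close>

lemma closed_solution_endpoints:
  fixes F :: "'e::euclidean_space \<Rightarrow> 'e"
  assumes "compact P" and lip: "K-lipschitz_on P F" and "compact T"
  shows "closed {(p, q). \<exists>t\<in>T. \<exists>\<zeta>. \<zeta> 0 = p \<and> \<zeta> 1 = q \<and> (\<forall>s\<in>{0..1}. \<zeta> s \<in> P \<and>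
    (\<zeta> has_vector_derivative t *\<^sub>R F (\<zeta> s)) (at s within {0..1::real}))}" (is "closed ?E")
  unfolding closed_sequential_limits
proof (intro allI impI, elim conjE)
  fix u :: "nat \<Rightarrow> 'e \<times> 'e" and l
  assume u: "\<forall>n. u n \<in> ?E" and lim: "u \<longlonglongrightarrow> l"
  have "\<exists>t \<zeta>. t \<in> T \<and> \<zeta> 0 = fst (u n) \<and> \<zeta> 1 = snd (u n) \<and> (\<forall>s\<in>{0..1}. \<zeta> s \<in> P \<and>
    (\<zeta> has_vector_derivative t *\<^sub>R F (\<zeta> s)) (at s within {0..1}))" for n
    using u[rule_format, of n] by (auto simp: case_prod_beta)
  then obtain t \<zeta> where tT: "\<And>n. t n \<in> T"
    and ends: "\<And>n. \<zeta> n 0 = fst (u n)" "\<And>n. \<zeta> n 1 = snd (u n)"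
    and P: "\<And>n s. s \<in> {0..1} \<Longrightarrow> \<zeta> n s \<in> P"
    and D: "\<And>n s. s \<in> {0..1} \<Longrightarrow>
        (\<zeta> n has_vector_derivative t n *\<^sub>R F (\<zeta> n s)) (at s within {0..1})"
    by metis
  obtain C where C: "\<And>p. p \<in> P \<Longrightarrow> norm p \<le> C"
    using compact_imp_bounded[OF \<open>compact P\<close>] by (auto simp: bounded_iff)
  have "compact (F ` P)"
    using \<open>compact P\<close> lip lipschitz_on_continuous_on compact_continuous_image by blast
  then obtain M where M: "\<And>p. p \<in> P \<Longrightarrow> norm (F p) \<le> M" and "M > 0"
    using compact_imp_bounded by (fastforce simp: bounded_pos)
  obtain R where R: "\<And>t. t \<in> T \<Longrightarrow> \<bar>t\<bar> \<le> R" and "R > 0"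
    using compact_imp_bounded[OF \<open>compact T\<close>] by (auto simp: bounded_pos)
  \<comment> \<open>The speed is at most \<open>R * M\<close>, the bound on the times times the
    bound on \<open>F\<close>. This Lipschitz constant is independent of \<open>n\<close>, which
    gives equicontinuity.\<close>
  have equi: "norm (\<zeta> n x - \<zeta> n y) \<le> R * M * norm (x - y)"
    if "x \<in> {0..1}" "y \<in> {0..1}" for n x y
  proof (rule differentiable_bound[OF convex_real_interval(5) _ _ that])
    show "(\<zeta> n has_derivative (\<lambda>h. h *\<^sub>R (t n *\<^sub>R F (\<zeta> n s)))) (at s within {0..1})"
      if "s \<in> {0..1}" for s
      using D[OF that] by (simp add: has_vector_derivative_def)
    show "onorm (\<lambda>h. h *\<^sub>R (t n *\<^sub>R F (\<zeta> n s))) \<le> R * M" if "s \<in> {0..1}" for s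
    proof (rule onorm_le)
      fix h :: real
      have "\<bar>t n\<bar> * norm (F (\<zeta> n s)) \<le> R * M"
        using R[OF tT] M[OF P[OF that]] \<open>R > 0\<close> by (intro mult_mono) auto
      then show "norm (h *\<^sub>R (t n *\<^sub>R F (\<zeta> n s))) \<le> R * M * norm h"
        using mult_left_mono[of "\<bar>t n\<bar> * norm (F (\<zeta> n s))" "R * M" "\<bar>h\<bar>"]
        by (simp add: abs_mult ac_simps)
    qed
  qed
  obtain \<zeta>' k where k: "strict_mono (k :: nat \<Rightarrow> nat)"
    and unif: "\<And>e. 0 < e \<Longrightarrow> \<exists>N. \<forall>n x. n \<ge> N \<and> x \<in> {0..1} \<longrightarrow> norm (\<zeta> (k n) x - \<zeta>' x) < e"
  proof (rule Arzela_Ascoli[of "{0..1::real}" \<zeta> C])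
    show "\<exists>d. 0 < d \<and> (\<forall>n y. y \<in> {0..1} \<and> norm (x - y) < d \<longrightarrow> norm (\<zeta> n x - \<zeta> n y) < e)"
      if "x \<in> {0..1}" "0 < e" for x e :: real
    proof (intro exI conjI allI impI)
      show "0 < e / (R * M)" using \<open>e > 0\<close> \<open>R > 0\<close> \<open>M > 0\<close> by simp
      fix n y assume "y \<in> {0..1} \<and> norm (x - y) < e / (R * M)"
      then show "norm (\<zeta> n x - \<zeta> n y) < e"
        using equi[OF that(1), of y n] \<open>R > 0\<close> \<open>M > 0\<close> by (simp add: field_simps)
    qed
  qed (use P C in auto)
  \<comment> \<open>A second extraction makes the life times converge along with the curves.\<close>
  obtain t' k' where "t' \<in> T" and k': "strict_mono (k' :: nat \<Rightarrow> nat)"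
    and t': "(\<lambda>n. t (k (k' n))) \<longlonglongrightarrow> t'"
    using seq_compactE[OF compact_imp_seq_compact[OF \<open>compact T\<close>], of "\<lambda>n. t (k n)"] tT
    unfolding o_def by metis
  define j where "j n = k (k' n)" for n
  have j: "strict_mono j" using k k' by (simp add: j_def strict_mono_def)
  have unif': "\<forall>\<^sub>F n in sequentially. \<forall>x\<in>{0..1}. norm (\<zeta> (j n) x - \<zeta>' x) < e" if "0 < e" for e
  proof -
    obtain N where N: "\<And>n x. n \<ge> N \<Longrightarrow> x \<in> {0..1} \<Longrightarrow> norm (\<zeta> (k n) x - \<zeta>' x) < e"
      using unif[OF \<open>0 < e\<close>] by blast
    have "k' n \<ge> N" if "n \<ge> N" for n using seq_suble[OF k', of n] that by simp
    then show ?thesis unfolding eventually_sequentially j_def using N by blast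
  qed
  have ptw: "(\<lambda>n. \<zeta> (j n) x) \<longlonglongrightarrow> \<zeta>' x" if "x \<in> {0..1}" for x
    unfolding tendsto_iff dist_norm
  proof (intro allI impI)
    show "\<forall>\<^sub>F n in sequentially. norm (\<zeta> (j n) x - \<zeta>' x) < e" if "0 < e" for e
      by (rule eventually_mono[OF unif'[OF that]]) (use \<open>x \<in> {0..1}\<close> in auto)
  qed
  have P': "\<zeta>' x \<in> P" if "x \<in> {0..1}" for x
    by (rule closed_sequentially[OF compact_imp_closed[OF \<open>compact P\<close>] P[OF that] ptw[OF that]])
  \<comment> \<open>The curves converge and their derivatives converge uniformly, so the limit may
    be differentiated. The resulting \<open>g\<close> is the pointwise limit as well, hence equals
    \<open>\<zeta>'\<close> on the unit interval.\<close>
  have D': "(\<zeta>' has_vector_derivative t' *\<^sub>R F (\<zeta>' s)) (at s within {0..1})" if s: "s \<in> {0..1}" for s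
  proof -
    have "\<exists>g. \<forall>x\<in>{0..1}. (\<lambda>n. \<zeta> (j n) x) \<longlonglongrightarrow> g x \<and>
        (g has_derivative (\<lambda>h. h *\<^sub>R (t' *\<^sub>R F (\<zeta>' x)))) (at x within {0..1})"
    proof (rule has_derivative_sequence[where ?x0.0 = 0 and l = "\<zeta>' 0"])
      show "(\<zeta> (j n) has_derivative (\<lambda>h. h *\<^sub>R (t (j n) *\<^sub>R F (\<zeta> (j n) x)))) (at x within {0..1})"
        if "x \<in> {0..1}" for n x
        using D[OF that] by (simp add: has_vector_derivative_def)
      fix e :: real assume "e > 0"
      have K: "K \<ge> 0" using lip lipschitz_on_nonneg by blast
      \<comment> \<open>The error splits into a change of \<open>F\<close> with weight
        \<open>t (j n)\<close> and a change of time with weight \<open>F (\<zeta>' x)\<close>; each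
        gets \<open>e / 2\<close>. The constant \<open>K + 1\<close> replaces \<open>K\<close>,
        which may be 0, in the denominator.\<close>
      have e1: "e / (2 * M) > 0" "e / (2 * R * (K + 1)) > 0"
        using \<open>e > 0\<close> \<open>M > 0\<close> \<open>R > 0\<close> K by auto
      have "\<forall>\<^sub>F n in sequentially. \<bar>t (j n) - t'\<bar> < e / (2 * M)"
        using t' e1(1) unfolding tendsto_iff j_def dist_real_def by blast
      then show "\<forall>\<^sub>F n in sequentially. \<forall>x\<in>{0..1}. \<forall>h.
          norm (h *\<^sub>R (t (j n) *\<^sub>R F (\<zeta> (j n) x)) - h *\<^sub>R (t' *\<^sub>R F (\<zeta>' x))) \<le> e * norm h"
        using unif'[OF e1(2)]
      proof eventually_elim
        case (elim n)
        show ?case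
        proof (intro ballI allI)
          fix x h :: real assume x: "x \<in> {0..1}"
          let ?a = "F (\<zeta> (j n) x)" and ?b = "F (\<zeta>' x)"
          have ab: "norm (?a - ?b) \<le> (K + 1) * norm (\<zeta> (j n) x - \<zeta>' x)"
            using lipschitz_onD[OF lip P[OF x, of "j n"] P'[OF x]]
            by (simp add: dist_norm distrib_right)
              (smt (verit) norm_ge_zero)
          have "norm (t (j n) *\<^sub>R ?a - t' *\<^sub>R ?b) = norm (t (j n) *\<^sub>R (?a - ?b) + (t (j n) - t') *\<^sub>R ?b)"
            by (simp add: algebra_simps)
          also have "\<dots> \<le> \<bar>t (j n)\<bar> * norm (?a - ?b) + \<bar>t (j n) - t'\<bar> * norm ?b"
            by (rule order_trans[OF norm_triangle_ineq]) simp
          also have "\<dots> \<le> R * ((K + 1) * (e / (2 * R * (K + 1)))) + (e / (2 * M)) * M"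
          proof (intro add_mono mult_mono)
            show "norm (?a - ?b) \<le> (K + 1) * (e / (2 * R * (K + 1)))"
              using elim(2) x K by (intro order_trans[OF ab] mult_left_mono) (auto intro: less_imp_le)
          qed (use R tT M P' x elim(1) \<open>R > 0\<close> \<open>M > 0\<close> \<open>e > 0\<close> K in \<open>auto intro: less_imp_le\<close>)
          also have "\<dots> = e"
            using \<open>R > 0\<close> \<open>M > 0\<close> K
            by (simp add: add_nonneg_eq_0_iff less_imp_neq[symmetric])
          finally have "norm (t (j n) *\<^sub>R ?a - t' *\<^sub>R ?b) \<le> e" .
          then show "norm (h *\<^sub>R (t (j n) *\<^sub>R ?a) - h *\<^sub>R (t' *\<^sub>R ?b)) \<le> e * norm h"
            using mult_left_mono[of "norm (t (j n) *\<^sub>R ?a - t' *\<^sub>R ?b)" e "\<bar>h\<bar>"]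
            by (simp add: mult.commute del: scaleR_scaleR flip: scaleR_diff_right)
        qed
      qed
    qed (use ptw in auto)
    then obtain g where g: "\<And>x. x \<in> {0..1} \<Longrightarrow> (\<lambda>n. \<zeta> (j n) x) \<longlonglongrightarrow> g x"
      "\<And>x. x \<in> {0..1} \<Longrightarrow> (g has_vector_derivative (t' *\<^sub>R F (\<zeta>' x))) (at x within {0..1})"
      unfolding has_vector_derivative_def by blast
    have "\<zeta>' x = g x" if "x \<in> {0..1}" for x
      using LIMSEQ_unique[OF ptw[OF that] g(1)[OF that]] .
    then show ?thesis
      using g(2)[OF s] s has_vector_derivative_transform by blast
  qed
  have "(\<lambda>n. u (j n)) \<longlonglongrightarrow> l"
    using LIMSEQ_subseq_LIMSEQ[OF lim j] by (simp add: o_def)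
  then have "(\<lambda>n. fst (u (j n))) \<longlonglongrightarrow> fst l" "(\<lambda>n. snd (u (j n))) \<longlonglongrightarrow> snd l"
    by (auto intro: tendsto_fst tendsto_snd)
  then have "\<zeta>' 0 = fst l" "\<zeta>' 1 = snd l"
    using LIMSEQ_unique[OF ptw[of 0, unfolded ends]] LIMSEQ_unique[OF ptw[of 1, unfolded ends]]
    by simp_all
  then show "l \<in> ?E"
    unfolding case_prod_beta mem_Collect_eq
    using \<open>t' \<in> T\<close> P' D' by (intro bexI[of _ t'] exI[of _ \<zeta>']) simp_all
qed

section \<open>Integral curves\<close>

lemma has_vector_derivative_Un:
  assumes "(f has_vector_derivative D) (at x within S)" "(f has_vector_derivative D) (at x within T)"
  shows "(f has_vector_derivative D) (at x within S \<union> T)"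
  using assms unfolding has_vector_derivative_def has_derivative_within by (auto simp: Lim_within_Un)

text \<open>The filter is trivial there, so every vector is a derivative. When two curves are
  joined, an interval away from \<open>t\<close> thus imposes no condition at
  \<open>t\<close>.\<close>

lemma has_vector_derivative_notin_closure:
  assumes "x \<notin> closure S"
  shows "(f has_vector_derivative D) (at x within S)"
proof -
  have "at x within S = bot"
    using assms by (simp add: closure_def trivial_limit_within)
  then show ?thesis
    by (simp add: has_vector_derivative_def has_derivative_def bounded_linear_scaleR_left)
qed

text \<open>The derivative condition on a one-point domain is vacuous. This supplies a curve through
  every point, to be extended to a maximal one.\<close>

lemma integral_curve_const:
  assumes "x \<in> topspace X"
  shows "integral_curve X A v {t} (\<lambda>_. x)"
  using assms
  by (auto simp: integral_curve_def has_vector_derivative_def has_derivative_within_singleton_iff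
      bounded_linear_scaleR_left is_interval_1)

lemma integral_curve_subset:
  assumes "integral_curve X A v I \<gamma>" "is_interval J" "J \<noteq> {}" "J \<subseteq> I"
  shows "integral_curve X A v J \<gamma>"
  using assms unfolding integral_curve_def
  by (meson continuous_map_from_subtopology_mono has_vector_derivative_within_subset subset_iff)

lemma integral_curve_cong:
  assumes "integral_curve X A v I \<gamma>" and eq: "\<And>t. t \<in> I \<Longrightarrow> \<delta> t = \<gamma> t"
  shows "integral_curve X A v I \<delta>"
  unfolding integral_curve_def
proof (intro conjI ballI impI)
  have \<gamma>: "continuous_map (top_of_set I) X \<gamma>"
    "\<And>t c. \<lbrakk>t \<in> I; c \<in> A; \<gamma> t \<in> cdom c\<rbrakk> \<Longrightarrow>
        ((coord c \<circ> \<gamma>) has_vector_derivative v c (\<gamma> t)) (at t within I)"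
    using assms(1) by (auto simp: integral_curve_def)
  show "continuous_map (top_of_set I) X \<delta>"
    using \<gamma>(1) by (rule continuous_map_eq) (simp add: eq)
  fix t c assume "t \<in> I" "c \<in> A" "\<delta> t \<in> cdom c"
  then show "((coord c \<circ> \<delta>) has_vector_derivative v c (\<delta> t)) (at t within I)"
    using \<gamma>(2)[of t c] by (auto simp: eq intro: has_vector_derivative_transform[rotated 2])
qed (use assms(1) in \<open>auto simp: integral_curve_def\<close>)

text \<open>One statement for time shifts (\<open>a = 1\<close>), time reversal
  (\<open>a = - 1\<close>, where the field becomes its negative) and rescaling to and from the unit
  interval.\<close>

lemma integral_curve_affine:
  assumes "integral_curve X A v I \<gamma>" "is_interval J" "J \<noteq> {}"
    and JI: "\<And>t. t \<in> J \<Longrightarrow> a * t + s \<in> I"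
  shows "integral_curve X A (\<lambda>c x. a *\<^sub>R v c x) J (\<lambda>t. \<gamma> (a * t + s))"
  unfolding integral_curve_def
proof (intro conjI ballI impI)
  have \<gamma>: "continuous_map (top_of_set I) X \<gamma>"
    "\<And>t c. \<lbrakk>t \<in> I; c \<in> A; \<gamma> t \<in> cdom c\<rbrakk> \<Longrightarrow>
        ((coord c \<circ> \<gamma>) has_vector_derivative v c (\<gamma> t)) (at t within I)"
    using assms(1) by (auto simp: integral_curve_def)
  have "continuous_map (top_of_set J) (top_of_set I) (\<lambda>t. a * t + s)"
    using JI by (auto intro!: continuous_intros)
  from continuous_map_compose[OF this \<gamma>(1)]
  show "continuous_map (top_of_set J) X (\<lambda>t. \<gamma> (a * t + s))"
    by (simp add: o_def)
  fix t c assume t: "t \<in> J" "c \<in> A" "\<gamma> (a * t + s) \<in> cdom c"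
  have "((\<lambda>t. a * t + s) has_vector_derivative a) (at t within J)"
    by (auto intro!: derivative_eq_intros)
  moreover have "((coord c \<circ> \<gamma>) has_vector_derivative v c (\<gamma> (a * t + s)))
      (at (a * t + s) within (\<lambda>t. a * t + s) ` J)"
    by (rule has_vector_derivative_within_subset[OF \<gamma>(2)]) (use t JI in auto)
  ultimately have "((coord c \<circ> \<gamma> \<circ> (\<lambda>t. a * t + s)) has_vector_derivative
      a *\<^sub>R v c (\<gamma> (a * t + s))) (at t within J)"
    by (rule vector_diff_chain_within)
  then show "((coord c \<circ> (\<lambda>t. \<gamma> (a * t + s))) has_vector_derivative
      a *\<^sub>R v c (\<gamma> (a * t + s))) (at t within J)"
    by (simp add: o_def)
qed (use assms in auto)

lemma integral_curve_shift:
  assumes "integral_curve X A v I \<gamma>" "is_interval J" "J \<noteq> {}" "\<And>t. t \<in> J \<Longrightarrow> t + s \<in> I"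
  shows "integral_curve X A v J (\<lambda>t. \<gamma> (t + s))"
  using integral_curve_affine[of X A v I \<gamma> J 1 s] assms by simp

lemma integral_curve_concat:
  assumes \<gamma>: "integral_curve X A v I \<gamma>" and \<delta>: "integral_curve X A v J \<delta>"
    and IJ: "I \<subseteq> {..t0}" "J \<subseteq> {t0..}" "t0 \<in> I" "t0 \<in> J" and eq: "\<gamma> t0 = \<delta> t0"
  shows "integral_curve X A v (I \<union> J) (\<lambda>t. if t \<le> t0 then \<gamma> t else \<delta> t)" (is "integral_curve X A v _ ?\<zeta>")
  unfolding integral_curve_def
proof (intro conjI ballI impI)
  have on: "?\<zeta> t = \<gamma> t" if "t \<in> I" for t
    using that IJ by auto
  have onJ: "?\<zeta> t = \<delta> t" if "t \<in> J" for t
    using that IJ eq by force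
  have \<gamma>': "integral_curve X A v I ?\<zeta>" and \<delta>': "integral_curve X A v J ?\<zeta>"
    using integral_curve_cong[OF \<gamma> on] integral_curve_cong[OF \<delta> onJ] by simp_all
  have "is_interval I" "is_interval J"
    using \<gamma> \<delta> by (auto simp: integral_curve_def)
  then show "is_interval (I \<union> J)"
    using IJ unfolding is_interval_connected_1 by (intro connected_Un) auto
  have I': "{x \<in> I \<union> J. x \<le> t0} = I" and J': "{x \<in> I \<union> J. t0 \<le> x} = J"
    using IJ by force+
  show "continuous_map (top_of_set (I \<union> J)) X ?\<zeta>"
  proof (rule continuous_map_cases_le)
    show "continuous_map (subtopology (top_of_set (I \<union> J)) {x \<in> topspace (top_of_set (I \<union> J)). x \<le> t0}) X \<gamma>"
      using \<gamma> I' by (simp add: integral_curve_def subtopology_subtopology)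
    show "continuous_map (subtopology (top_of_set (I \<union> J)) {x \<in> topspace (top_of_set (I \<union> J)). t0 \<le> x}) X \<delta>"
      using \<delta> J' by (simp add: integral_curve_def subtopology_subtopology)
  qed (use eq in auto)
  fix t c assume t: "t \<in> I \<union> J" "c \<in> A" "?\<zeta> t \<in> cdom c"
  \<comment> \<open>The closures can meet only at \<open>t0\<close>, which lies in both intervals.
    Hence a time missing from one interval is also outside its closure, and the derivative condition
    there is vacuous.\<close>
  have "closure I \<subseteq> {..t0}" "closure J \<subseteq> {t0..}"
    using IJ by (simp_all add: closure_minimal)
  then have cl: "t \<notin> closure I" if "t \<notin> I"
    using that t(1) IJ by (metis IntI Un_iff atLeast_iff atMost_iff order_antisym subset_iff)
  have cl': "t \<notin> closure J" if "t \<notin> J"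
    using that t(1) IJ \<open>closure J \<subseteq> {t0..}\<close>
    by (metis IntI Un_iff atLeast_iff atMost_iff order_antisym subset_iff)
  show "((coord c \<circ> ?\<zeta>) has_vector_derivative v c (?\<zeta> t)) (at t within I \<union> J)"
  proof (rule has_vector_derivative_Un)
    show "((coord c \<circ> ?\<zeta>) has_vector_derivative v c (?\<zeta> t)) (at t within I)"
      using \<gamma>' t cl has_vector_derivative_notin_closure unfolding integral_curve_def by blast
    show "((coord c \<circ> ?\<zeta>) has_vector_derivative v c (?\<zeta> t)) (at t within J)"
      using \<delta>' t cl' has_vector_derivative_notin_closure unfolding integral_curve_def by blast
  qed
qed (use IJ in auto)

text \<open>Being an integral curve at \<open>t\<close> depends only on the germ of the domain at
  \<open>t\<close>, and \<open>I \<inter> S \<subseteq> J \<subseteq> I\<close> forces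
  \<open>I\<close> and \<open>J\<close> to have the same germ.\<close>

lemma integral_curve_local:
  assumes "is_interval I" "I \<noteq> {}"
    and loc: "\<And>t. t \<in> I \<Longrightarrow> \<exists>S J. open S \<and> t \<in> S \<and> t \<in> J \<and> I \<inter> S \<subseteq> J \<and> J \<subseteq> I \<and> integral_curve X A v J \<gamma>"
  shows "integral_curve X A v I \<gamma>"
  unfolding integral_curve_def
proof (intro conjI ballI impI)
  define \<S> where "\<S> = {S. open S \<and> (\<exists>J. I \<inter> S \<subseteq> J \<and> integral_curve X A v J \<gamma>)}"
  show "continuous_map (top_of_set I) X \<gamma>"
  proof (rule pasting_lemma[where f = "\<lambda>_. \<gamma>"])
    fix S assume "S \<in> \<S>"
    then obtain J where "open S" and J: "I \<inter> S \<subseteq> J" "integral_curve X A v J \<gamma>"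
      by (auto simp: \<S>_def)
    show "openin (top_of_set I) (I \<inter> S)"
      using \<open>open S\<close> by (simp add: openin_open_Int)
    have "continuous_map (top_of_set J) X \<gamma>"
      using J(2) by (simp add: integral_curve_def)
    from continuous_map_from_subtopology_mono[OF this J(1)]
    show "continuous_map (subtopology (top_of_set I) (I \<inter> S)) X \<gamma>"
      by (simp add: subtopology_subtopology)
  next
    fix t assume "t \<in> topspace (top_of_set I)"
    then show "\<exists>S. S \<in> \<S> \<and> t \<in> I \<inter> S \<and> \<gamma> t = \<gamma> t"
      using loc[of t] by (auto simp: \<S>_def)
  qed auto
  fix t c assume t: "t \<in> I" "c \<in> A" "\<gamma> t \<in> cdom c"
  obtain S J where S: "open S" "t \<in> S" "t \<in> J" and J: "I \<inter> S \<subseteq> J" "J \<subseteq> I" "integral_curve X A v J \<gamma>"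
    using loc[OF t(1)] by auto
  have "at t within I = at t within J"
    by (rule at_within_nhd[OF S(2) S(1)]) (use J in blast)
  then show "((coord c \<circ> \<gamma>) has_vector_derivative v c (\<gamma> t)) (at t within I)"
    using J(3) S(3) t by (auto simp: integral_curve_def)
qed fact+

section \<open>Charts\<close>

lemma closed_half_space: "closed (half_space :: 'e::euclidean_space set)"
  unfolding half_space_def by (intro closed_Collect_le continuous_intros)

lemma chart_on_props:
  assumes "chart_on X c"
  shows "openin X (cdom c)" "cdom c \<subseteq> topspace X" "inj_on (coord c) (cdom c)"
    "coord c ` cdom c \<subseteq> half_space"
    "continuous_map (subtopology X (cdom c)) euclidean (coord c)"
    "continuous_map (top_of_set (coord c ` cdom c)) X (cinv c)"
proof -
  have o: "openin X (cdom c)" "openin (top_of_set half_space) (coord c ` cdom c)"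
    and h: "homeomorphic_map (subtopology X (cdom c)) (top_of_set (coord c ` cdom c)) (coord c)"
    using assms by (auto simp: chart_on_def)
  show "openin X (cdom c)" by fact
  show sub: "cdom c \<subseteq> topspace X"
    using o(1) by (rule openin_subset)
  then have ts: "topspace (subtopology X (cdom c)) = cdom c" by auto
  show "coord c ` cdom c \<subseteq> half_space"
    using openin_subset[OF o(2)] by simp
  show inj: "inj_on (coord c) (cdom c)"
    using homeomorphic_imp_injective_map[OF h] ts by simp
  show "continuous_map (subtopology X (cdom c)) euclidean (coord c)"
    using homeomorphic_imp_continuous_map[OF h] continuous_map_into_fulltopology by blast
  obtain k where k: "homeomorphic_maps (subtopology X (cdom c)) (top_of_set (coord c ` cdom c)) (coord c) k"
    using h homeomorphic_map_maps by blast
  then have "continuous_map (top_of_set (coord c ` cdom c)) X k"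
    and kc: "\<And>x. x \<in> cdom c \<Longrightarrow> k (coord c x) = x"
    using sub by (auto simp: homeomorphic_maps_def intro: continuous_map_into_fulltopology)
  from this(1) show "continuous_map (top_of_set (coord c ` cdom c)) X (cinv c)"
    by (rule continuous_map_eq) (use kc inj in \<open>auto simp: cinv_def\<close>)
qed

lemma cinv_coord:
  assumes "chart_on X c" "x \<in> cdom c"
  shows "cinv c (coord c x) = x"
  using chart_on_props(3)[OF assms(1)] assms(2) by (simp add: cinv_def)

lemma coord_cinv:
  assumes "p \<in> coord c ` cdom c"
  shows "cinv c p \<in> cdom c" "coord c (cinv c p) = p"
  using assms by (auto simp: cinv_def inv_into_into f_inv_into_f)

lemma openin_coord_preimage:
  assumes "chart_on X c" "open U"
  shows "openin X {x \<in> cdom c. coord c x \<in> U}"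
proof -
  have "openin (subtopology X (cdom c)) {x \<in> topspace (subtopology X (cdom c)). coord c x \<in> U}"
    using chart_on_props(5)[OF assms(1)] assms(2) openin_continuous_map_preimage by fastforce
  moreover have "topspace (subtopology X (cdom c)) = cdom c"
    using chart_on_props(2)[OF assms(1)] by auto
  ultimately show ?thesis
    using chart_on_props(1)[OF assms(1)] openin_trans_full by fastforce
qed

text \<open>In a Hausdorff space these sets are closed in all of \<open>X\<close>, whereas a
  preimage of a merely closed set is closed only relative to the chart domain.\<close>

lemma compactin_coord_preimage:
  assumes "chart_on X c" "compact P" "P \<subseteq> coord c ` cdom c"
  shows "compactin X {x \<in> cdom c. coord c x \<in> P}"
proof -
  have "compactin X (cinv c ` P)"
    using assms(2,3) chart_on_props(6)[OF assms(1)]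
    by (intro image_compactin[of "top_of_set (coord c ` cdom c)"]) (simp_all add: compactin_subtopology)
  moreover have "cinv c ` P = {x \<in> cdom c. coord c x \<in> P}"
  proof safe
    fix p assume "p \<in> P"
    then have "p \<in> coord c ` cdom c" using assms(3) by blast
    then show "cinv c p \<in> cdom c" "coord c (cinv c p) \<in> P"
      using \<open>p \<in> P\<close> coord_cinv by metis+
  next
    fix x assume "x \<in> cdom c" "coord c x \<in> P"
    then show "x \<in> cinv c ` P"
      using cinv_coord[OF assms(1)] by (metis imageI)
  qed
  ultimately show ?thesis by simp
qed

text \<open>Chain rule for the factorization of \<open>h \<circ> \<gamma>\<close> through the chart.
  It is available while \<open>\<gamma>\<close> stays in \<open>U\<close>, that is on a
  neighbourhood of \<open>t\<close> in \<open>I\<close>, which is enough. Used with \<open>h\<close>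
  another coordinate map and with \<open>h\<close> the Lyapunov function.\<close>

lemma has_vector_derivative_through_chart:
  assumes c: "chart_on X c" and U: "openin X U" "U \<subseteq> cdom c"
    and \<gamma>: "continuous_map (top_of_set I) X \<gamma>" "t \<in> I" "\<gamma> t \<in> U"
    and D\<gamma>: "((coord c \<circ> \<gamma>) has_vector_derivative u) (at t within I)"
    and Dh: "((h \<circ> cinv c) has_derivative D) (at (coord c (\<gamma> t)) within coord c ` U)"
  shows "((h \<circ> \<gamma>) has_vector_derivative D u) (at t within I)"
proof -
  have "openin (top_of_set I) {s \<in> I. \<gamma> s \<in> U}"
    using openin_continuous_map_preimage[OF \<gamma>(1) U(1)] by simp
  then obtain V where "open V" and V: "{s \<in> I. \<gamma> s \<in> U} = I \<inter> V"
    by (auto simp: openin_open)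
  have "t \<in> V" using V \<gamma> by blast
  have at: "at t within I \<inter> V = at t within I"
    by (rule at_within_nhd[OF \<open>t \<in> V\<close> \<open>open V\<close>]) blast
  have "((coord c \<circ> \<gamma>) has_vector_derivative u) (at t within I \<inter> V)"
    using D\<gamma> at by simp
  moreover have "((h \<circ> cinv c) has_derivative D) (at ((coord c \<circ> \<gamma>) t) within (coord c \<circ> \<gamma>) ` (I \<inter> V))"
    using has_derivative_subset[OF Dh, of "(coord c \<circ> \<gamma>) ` (I \<inter> V)"] V by force
  ultimately have "((h \<circ> cinv c \<circ> (coord c \<circ> \<gamma>)) has_vector_derivative D u) (at t within I \<inter> V)"
    by (rule vector_derivative_diff_chain_within)
  moreover have "(h \<circ> \<gamma>) s = (h \<circ> cinv c \<circ> (coord c \<circ> \<gamma>)) s" if "s \<in> I \<inter> V" for s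
    using that V U(2) cinv_coord[OF c] by fastforce
  ultimately have "((h \<circ> \<gamma>) has_vector_derivative D u) (at t within I \<inter> V)"
    using \<open>t \<in> V\<close> \<gamma>(2) has_vector_derivative_transform[of t "I \<inter> V"] by blast
  then show ?thesis using at by simp
qed


section \<open>Flows on compact manifolds\<close>

text \<open>A relation, since a solution may cease to exist at any time and uniqueness is only
  proved later. Negative \<open>t\<close> are excluded because the domain of an integral curve is
  nonempty.\<close>

definition flow ::
    "'a topology \<Rightarrow> ('a, 'e::euclidean_space) chart set \<Rightarrow> ('a, 'e) vfield \<Rightarrow> real \<Rightarrow> 'a \<Rightarrow> 'a \<Rightarrow> bool" where
  "flow X A v t x y \<longleftrightarrow> (\<exists>\<gamma>. integral_curve X A v {0..t} \<gamma> \<and> \<gamma> 0 = x \<and> \<gamma> t = y)"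

text \<open>Smoothness is reduced to a derivative for each change of chart and a Lipschitz bound
  near each point. Both conditions pass directly to the negative field, so forward results also
  serve backward in time.\<close>

locale compact_vfield =
  fixes X :: "'a topology" and A :: "('a, 'e::euclidean_space) chart set" and v :: "('a, 'e) vfield"
  assumes hausdorff: "Hausdorff_space X" and compact: "compact_space X"
    and chart: "\<And>c. c \<in> A \<Longrightarrow> chart_on X c"
    and cover: "(\<Union>c\<in>A. cdom c) = topspace X"
    and change: "\<And>c d x. \<lbrakk>c \<in> A; d \<in> A; x \<in> cdom c \<inter> cdom d\<rbrakk> \<Longrightarrow>
      \<exists>D. ((coord d \<circ> cinv c) has_derivative D) (at (coord c x) within coord c ` (cdom c \<inter> cdom d)) \<and>
          D (v c x) = v d x"
    and lipschitz: "\<And>c x. \<lbrakk>c \<in> A; x \<in> cdom c\<rbrakk> \<Longrightarrow>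
      \<exists>r>0. \<exists>K. cball (coord c x) r \<inter> half_space \<subseteq> coord c ` cdom c \<and>
        K-lipschitz_on (cball (coord c x) r \<inter> half_space) (v c \<circ> cinv c)"
begin

abbreviation curve :: "real set \<Rightarrow> (real \<Rightarrow> 'a) \<Rightarrow> bool" where
  "curve \<equiv> integral_curve X A v"

lemma curve_topspace: "curve I \<gamma> \<Longrightarrow> t \<in> I \<Longrightarrow> \<gamma> t \<in> topspace X"
  unfolding integral_curve_def continuous_map_def by auto

text \<open>The transformation law carries the velocity from the chart \<open>c\<close> to every
  other chart. The factor \<open>a\<close> comes out of the derivative by linearity and admits
  rescaled curves.\<close>

lemma integral_curve_from_chart:
  assumes "c \<in> A" "is_interval I" "I \<noteq> {}" and \<gamma>: "continuous_map (top_of_set I) X \<gamma>"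
    and dom: "\<And>t. t \<in> I \<Longrightarrow> \<gamma> t \<in> cdom c"
    and der: "\<And>t. t \<in> I \<Longrightarrow> ((coord c \<circ> \<gamma>) has_vector_derivative a *\<^sub>R v c (\<gamma> t)) (at t within I)"
  shows "integral_curve X A (\<lambda>c x. a *\<^sub>R v c x) I \<gamma>"
  unfolding integral_curve_def
proof (intro conjI ballI impI)
  fix t d assume t: "t \<in> I" "d \<in> A" "\<gamma> t \<in> cdom d"
  then obtain D where D: "D (v c (\<gamma> t)) = v d (\<gamma> t)"
    "((coord d \<circ> cinv c) has_derivative D) (at (coord c (\<gamma> t)) within coord c ` (cdom c \<inter> cdom d))"
    using change[OF \<open>c \<in> A\<close> \<open>d \<in> A\<close>, of "\<gamma> t"] dom by blast
  have "openin X (cdom c \<inter> cdom d)"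
    using chart_on_props(1) chart \<open>c \<in> A\<close> \<open>d \<in> A\<close> by blast
  then have "((coord d \<circ> \<gamma>) has_vector_derivative D (a *\<^sub>R v c (\<gamma> t))) (at t within I)"
    using has_vector_derivative_through_chart[OF chart[OF \<open>c \<in> A\<close>] _ _ \<gamma> t(1) _ der D(2)] t dom by auto
  moreover have "D (a *\<^sub>R v c (\<gamma> t)) = a *\<^sub>R v d (\<gamma> t)"
    using has_derivative_linear[OF D(2)] D(1) by (simp add: linear_cmul)
  ultimately show "((coord d \<circ> \<gamma>) has_vector_derivative a *\<^sub>R v d (\<gamma> t)) (at t within I)"
    by simp
qed (use assms in auto)

lemma curve_coord_derivative:
  assumes "curve I \<gamma>" "t \<in> I" "c \<in> A" "\<gamma> t \<in> cdom c"
  shows "((coord c \<circ> \<gamma>) has_vector_derivative v c (\<gamma> t)) (at t within I)"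
  using assms by (auto simp: integral_curve_def)

text \<open>The velocity is bounded near \<open>x\<close>, so for a short time curves starting close to \<open>x\<close> cannot
  leave a given compact coordinate neighbourhood: at the first exit time they would still be in a
  smaller compact, hence closed, set.\<close>

lemma chart_trap:
  assumes "x \<in> topspace X"
  obtains c N \<tau> P K where "c \<in> A" "openin X N" "x \<in> N" "N \<subseteq> cdom c" "0 < \<tau>" "compact P" "P \<subseteq> coord c ` cdom c"
    "K-lipschitz_on P (v c \<circ> cinv c)"
    "\<And>\<gamma> t s. \<lbrakk>curve {0..t} \<gamma>; \<gamma> 0 \<in> N; t \<le> \<tau>; s \<in> {0..t}\<rbrakk> \<Longrightarrow> \<gamma> s \<in> cdom c \<and> coord c (\<gamma> s) \<in> P"
proof -
  obtain c where "c \<in> A" "x \<in> cdom c"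
    using assms cover by blast
  note c = chart[OF \<open>c \<in> A\<close>]
  obtain r K where "r > 0" and sub: "cball (coord c x) r \<inter> half_space \<subseteq> coord c ` cdom c"
    and lip: "K-lipschitz_on (cball (coord c x) r \<inter> half_space) (v c \<circ> cinv c)"
    using lipschitz[OF \<open>c \<in> A\<close> \<open>x \<in> cdom c\<close>] by blast
  define p where "p = coord c x"
  define P where "P = cball p r \<inter> half_space"
  have cpt: "compact (cball p s \<inter> half_space)" for s
    by (intro compact_Int_closed compact_cball closed_half_space)
  have "continuous_on P (v c \<circ> cinv c)"
    using lipschitz_on_continuous_on[OF lip] by (simp add: P_def p_def)
  moreover have "compact P"
    unfolding P_def by (rule cpt)
  ultimately have "compact ((v c \<circ> cinv c) ` P)"
    by (rule compact_continuous_image)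
  then obtain M where "M > 0" and "\<forall>y \<in> (v c \<circ> cinv c) ` P. norm y \<le> M"
    using compact_imp_bounded bounded_pos by blast
  then have M: "\<And>q. q \<in> P \<Longrightarrow> norm (v c (cinv c q)) \<le> M"
    by simp
  \<comment> \<open>At speed at most \<open>M\<close>, a curve starting within \<open>r / 2\<close>
    of \<open>p\<close> moves at most \<open>M * \<tau> = r / 4\<close> and stays within
    \<open>3 * r / 4 < r\<close>. These are the radii of \<open>N\<close>, \<open>Q\<close> and
    \<open>U\<close>.\<close>
  define \<tau> where "\<tau> = r / (4 * M)"
  define N where "N = {y \<in> cdom c. coord c y \<in> ball p (r / 2)}"
  define U where "U = {y \<in> cdom c. coord c y \<in> ball p r}"
  define Q where "Q = {y \<in> cdom c. coord c y \<in> cball p (3 * r / 4) \<inter> half_space}"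
  have half: "coord c y \<in> half_space" if "y \<in> cdom c" for y
    using chart_on_props(4)[OF c] that by blast
  have oU: "openin X U"
    unfolding U_def by (rule openin_coord_preimage[OF c]) simp
  have "cball p (3 * r / 4) \<subseteq> cball p r"
    using \<open>r > 0\<close> by (intro subset_cball) simp
  then have "cball p (3 * r / 4) \<inter> half_space \<subseteq> coord c ` cdom c"
    using sub unfolding p_def by blast
  then have cQ: "closedin X Q"
    unfolding Q_def by (intro compactin_imp_closedin[OF hausdorff] compactin_coord_preimage[OF c] cpt)
  have inU: "\<gamma> s \<in> U" if \<gamma>: "curve {0..t} \<gamma>" "\<gamma> 0 \<in> N" "t \<le> \<tau>" "s \<in> {0..t}" for \<gamma> t s
  proof (rule ccontr)
    assume "\<gamma> s \<notin> U"
    have cont: "continuous_map (top_of_set {0..t}) X \<gamma>"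
      using \<gamma> by (simp add: integral_curve_def)
    define E where "E = {s \<in> {0..t}. \<gamma> s \<in> topspace X - U}"
    have "closedin (top_of_set {0..t}) E"
      unfolding E_def using closedin_continuous_map_preimage[OF cont, of "topspace X - U"] oU by auto
    then have "compact E"
      using closedin_compact by blast
    moreover have "s \<in> E"
      using \<open>\<gamma> s \<notin> U\<close> \<gamma> curve_topspace by (auto simp: E_def)
    ultimately obtain e where "e \<in> E" and e: "\<And>s. s \<in> E \<Longrightarrow> e \<le> s"
      using compact_attains_inf[of E] by blast
    have "e \<in> {0..t}" "\<gamma> e \<notin> U" using \<open>e \<in> E\<close> by (auto simp: E_def)
    moreover have "\<gamma> 0 \<in> U" using \<gamma>(2) \<open>r > 0\<close> by (auto simp: N_def U_def)
    ultimately have "0 < e" by (cases "e = 0") auto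
    have U: "\<gamma> s \<in> U" if "s \<in> {0..<e}" for s
      using e[of s] that \<open>e \<in> {0..t}\<close> curve_topspace[OF \<gamma>(1)] by (force simp: E_def)
    have Q: "\<gamma> s \<in> Q" if s: "s \<in> {0..<e}" for s
    proof -
      have sub: "{0..s} \<subseteq> {0..t}" using s \<open>e \<in> {0..t}\<close> by auto
      have inP: "\<gamma> u \<in> cdom c \<and> coord c (\<gamma> u) \<in> P" if "u \<in> {0..s}" for u
        using U[of u] that s half by (auto simp: U_def P_def)
      have "norm ((coord c \<circ> \<gamma>) s - (coord c \<circ> \<gamma>) 0) \<le> M * norm (s - 0)"
      proof (rule differentiable_bound[where S = "{0..s}"])
        fix u assume u: "u \<in> {0..s}"
        have "((coord c \<circ> \<gamma>) has_vector_derivative v c (\<gamma> u)) (at u within {0..s})"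
          by (rule has_vector_derivative_within_subset[OF curve_coord_derivative[OF \<gamma>(1)] sub])
            (use u sub inP \<open>c \<in> A\<close> in auto)
        then show "((coord c \<circ> \<gamma>) has_derivative (\<lambda>h. h *\<^sub>R v c (\<gamma> u))) (at u within {0..s})"
          by (simp add: has_vector_derivative_def)
        show "onorm (\<lambda>h. h *\<^sub>R v c (\<gamma> u)) \<le> M"
        proof (rule onorm_le)
          fix h :: real
          have "norm (v c (\<gamma> u)) \<le> M"
            using M[of "coord c (\<gamma> u)"] inP[OF u] cinv_coord[OF c] by simp
          from mult_right_mono[OF this, of "norm h"]
          show "norm (h *\<^sub>R v c (\<gamma> u)) \<le> M * norm h"
            by (simp add: mult.commute)
        qed
      qed (use s in auto)
      also have "\<dots> \<le> M * \<tau>"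
        using s \<gamma>(3) \<open>e \<in> {0..t}\<close> \<open>M > 0\<close> by (intro mult_left_mono) auto
      also have "\<dots> = r / 4" using \<open>M > 0\<close> by (simp add: \<tau>_def)
      finally have "dist (coord c (\<gamma> 0)) (coord c (\<gamma> s)) \<le> r / 4"
        by (simp add: dist_norm norm_minus_commute)
      moreover have "dist p (coord c (\<gamma> 0)) < r / 2"
        using \<gamma>(2) by (simp add: N_def)
      ultimately have "dist p (coord c (\<gamma> s)) \<le> 3 * r / 4"
        using dist_triangle[of p "coord c (\<gamma> s)" "coord c (\<gamma> 0)"] by simp
      then show ?thesis
        using inP[of s] s half by (auto simp: Q_def)
    qed
    have "closedin (top_of_set {0..t}) {s \<in> {0..t}. \<gamma> s \<in> Q}"
      using closedin_continuous_map_preimage[OF cont cQ] by simp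
    then have "closed {s \<in> {0..t}. \<gamma> s \<in> Q}"
      using closedin_closed_trans by blast
    moreover have "{0..<e} \<subseteq> {s \<in> {0..t}. \<gamma> s \<in> Q}"
      using Q \<open>e \<in> {0..t}\<close> by auto
    ultimately have "closure {0..<e} \<subseteq> {s \<in> {0..t}. \<gamma> s \<in> Q}"
      by (rule closure_minimal[rotated])
    moreover have "e \<in> closure {0..<e}"
      using \<open>0 < e\<close> by simp
    ultimately have "\<gamma> e \<in> Q"
      by blast
    then show False
      using \<open>\<gamma> e \<notin> U\<close> \<open>r > 0\<close> by (auto simp: Q_def U_def)
  qed
  show thesis
  proof (rule that)
    show "openin X N"
      unfolding N_def by (rule openin_coord_preimage[OF c]) simp
    show "compact P" "0 < \<tau>" "x \<in> N" "N \<subseteq> cdom c"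
      using cpt \<open>r > 0\<close> \<open>M > 0\<close> \<open>x \<in> cdom c\<close> by (auto simp: P_def \<tau>_def N_def p_def)
    show "P \<subseteq> coord c ` cdom c" "K-lipschitz_on P (v c \<circ> cinv c)"
      using sub lip by (auto simp: P_def p_def)
    show "\<gamma> s \<in> cdom c \<and> coord c (\<gamma> s) \<in> P"
      if "curve {0..t} \<gamma>" "\<gamma> 0 \<in> N" "t \<le> \<tau>" "s \<in> {0..t}" for \<gamma> t s
      using inU[OF that] half by (auto simp: U_def P_def)
  qed fact
qed

end

section \<open>Short-time flows: closedness, uniform times and uniqueness\<close>

lemma finite_uniform_bound:
  fixes Q :: "'b \<Rightarrow> real \<Rightarrow> bool"
  assumes "finite S" "\<And>x. x \<in> S \<Longrightarrow> \<exists>\<tau>>0. Q x \<tau>"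
    and anti: "\<And>x \<sigma> \<tau>. Q x \<tau> \<Longrightarrow> 0 < \<sigma> \<Longrightarrow> \<sigma> \<le> \<tau> \<Longrightarrow> Q x \<sigma>"
  shows "\<exists>\<tau>>0. \<forall>x\<in>S. Q x \<tau>"
  using assms(1,2)
proof (induction S)
  case empty
  show ?case by (intro exI[of _ 1]) simp
next
  case (insert a S)
  obtain \<tau> where "0 < \<tau>" "\<forall>x\<in>S. Q x \<tau>"
    using insert by auto
  moreover obtain \<sigma> where "0 < \<sigma>" "Q a \<sigma>"
    using insert.prems by auto
  ultimately show ?case
    by (intro exI[of _ "min \<sigma> \<tau>"]) (auto intro: anti)
qed

context compact_vfield
begin

text \<open>Together with the converse \<open>flow_cinv\<close>, this translates flows inside a
  chart into the endpoint relation of \<open>closed_solution_endpoints\<close>, with time rescaled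
  to the unit interval.\<close>

lemma flow_coord:
  assumes "c \<in> A" and \<gamma>: "curve {0..t} \<gamma>" and P: "\<And>s. s \<in> {0..t} \<Longrightarrow> \<gamma> s \<in> cdom c \<and> coord c (\<gamma> s) \<in> P"
  shows "\<exists>\<zeta>. \<zeta> 0 = coord c (\<gamma> 0) \<and> \<zeta> 1 = coord c (\<gamma> t) \<and> (\<forall>s\<in>{0..1}. \<zeta> s \<in> P \<and>
    (\<zeta> has_vector_derivative t *\<^sub>R (v c \<circ> cinv c) (\<zeta> s)) (at s within {0..1::real}))"
proof (intro exI conjI ballI)
  have "0 \<le> t" using \<gamma> by (simp add: integral_curve_def)
  then have st: "t * s \<in> {0..t}" if "s \<in> {0..1}" for s
    using that by (auto simp: mult_left_le)
  have ic: "integral_curve X A (\<lambda>c x. t *\<^sub>R v c x) {0..1} (\<lambda>s. \<gamma> (t * s + 0))"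
    by (rule integral_curve_affine[OF \<gamma>]) (use st in \<open>auto simp: is_interval_cc\<close>)
  fix s :: real assume s: "s \<in> {0..1}"
  show "coord c (\<gamma> (t * s)) \<in> P" using st[OF s] P by blast
  show "((\<lambda>s. coord c (\<gamma> (t * s))) has_vector_derivative
      t *\<^sub>R (v c \<circ> cinv c) (coord c (\<gamma> (t * s)))) (at s within {0..1})"
    using ic s P[OF st[OF s]] \<open>c \<in> A\<close> cinv_coord[OF chart[OF \<open>c \<in> A\<close>]]
    by (auto simp: integral_curve_def o_def)
qed auto

lemma flow_cinv:
  assumes "c \<in> A" "P \<subseteq> coord c ` cdom c" "0 \<le> t"
    and \<zeta>: "\<forall>s\<in>{0..1}. \<zeta> s \<in> P \<and>
      (\<zeta> has_vector_derivative t *\<^sub>R (v c \<circ> cinv c) (\<zeta> s)) (at s within {0..1::real})"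
  shows "flow X A v t (cinv c (\<zeta> 0)) (cinv c (\<zeta> 1))"
proof -
  have dom: "\<zeta> s \<in> coord c ` cdom c" if "s \<in> {0..1}" for s
    using \<zeta> assms(2) that by blast
  have c\<zeta>: "continuous_on {0..1} \<zeta>"
    using continuous_on_vector_derivative[of "{0..1}" \<zeta> "\<lambda>s. t *\<^sub>R (v c \<circ> cinv c) (\<zeta> s)"] \<zeta> by simp
  have ic: "integral_curve X A (\<lambda>c x. t *\<^sub>R v c x) {0..1} (cinv c \<circ> \<zeta>)"
  proof (rule integral_curve_from_chart[OF \<open>c \<in> A\<close>])
    show "continuous_map (top_of_set {0..1}) X (cinv c \<circ> \<zeta>)"
      by (rule continuous_map_compose[OF _ chart_on_props(6)[OF chart[OF \<open>c \<in> A\<close>]]])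
        (use c\<zeta> dom in auto)
    fix s :: real assume s: "s \<in> {0..1}"
    show "(cinv c \<circ> \<zeta>) s \<in> cdom c"
      using coord_cinv(1)[OF dom[OF s]] by simp
    show "((coord c \<circ> (cinv c \<circ> \<zeta>)) has_vector_derivative t *\<^sub>R v c ((cinv c \<circ> \<zeta>) s)) (at s within {0..1})"
    proof (rule has_vector_derivative_transform[OF s])
      show "(\<zeta> has_vector_derivative t *\<^sub>R v c ((cinv c \<circ> \<zeta>) s)) (at s within {0..1})"
        using \<zeta> s by simp
    qed (use coord_cinv(2)[OF dom] in simp)
  qed (auto simp: is_interval_cc)
  show ?thesis
  proof (cases "t = 0")
    \<comment> \<open>Rescaling by \<open>1 / t\<close> is impossible here; the velocity is 0, so
      \<open>\<zeta>\<close> is constant and the one-point curve serves.\<close>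
    case True
    have "\<exists>k. \<forall>s\<in>{0..1}. \<zeta> s = k"
      by (rule has_derivative_zero_constant[OF convex_real_interval(5)])
        (use \<zeta> True in \<open>simp add: has_vector_derivative_def\<close>)
    then have "\<zeta> 0 = \<zeta> 1" by force
    moreover have "cinv c (\<zeta> 0) \<in> topspace X"
      using coord_cinv(1)[OF dom[of 0]] chart_on_props(2)[OF chart[OF \<open>c \<in> A\<close>]] by auto
    ultimately show ?thesis
      using integral_curve_const[of "cinv c (\<zeta> 0)" X A v 0] True by (auto simp: flow_def)
  next
    case False
    then have "t > 0" using \<open>0 \<le> t\<close> by simp
    have "integral_curve X A (\<lambda>c x. (1 / t) *\<^sub>R t *\<^sub>R v c x) {0..t} (\<lambda>s. (cinv c \<circ> \<zeta>) (1 / t * s + 0))"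
      by (rule integral_curve_affine[OF ic]) (use \<open>t > 0\<close> in \<open>auto simp: is_interval_cc\<close>)
    then have "curve {0..t} (\<lambda>s. (cinv c \<circ> \<zeta>) (s / t))"
      using \<open>t > 0\<close> by simp
    then show ?thesis
      unfolding flow_def using \<open>t > 0\<close>
      by (intro exI[of _ "\<lambda>s. (cinv c \<circ> \<zeta>) (s / t)"]) simp
  qed
qed

text \<open>Short flows from \<open>N\<close> stay in a compact part of one chart, so over
  \<open>N\<close> the relation is the pullback of a closed set. Closedness is phrased as openness
  of the complement over \<open>N\<close>, so that finitely many \<open>N\<close> can be combined by
  a union. \<open>T\<close> is kept general because both \<open>{\<tau>}\<close> and
  \<open>{0..\<tau>}\<close> will be needed.\<close>

lemma flow_local:
  assumes "x \<in> topspace X"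
  obtains N \<tau> where "openin X N" "x \<in> N" "0 < \<tau>"
    "\<And>T. \<lbrakk>compact T; T \<subseteq> {0..\<tau>}\<rbrakk> \<Longrightarrow>
      openin (prod_topology X X) (N \<times> topspace X - {(y, z). \<exists>t\<in>T. flow X A v t y z})"
    "\<And>t y z z'. \<lbrakk>flow X A v t y z; flow X A v t y z'; y \<in> N; t \<le> \<tau>\<rbrakk> \<Longrightarrow> z = z'"
proof -
  obtain c N \<tau> P K where c: "c \<in> A" and N: "openin X N" "x \<in> N" "N \<subseteq> cdom c" and "0 < \<tau>"
    and P: "compact P" "P \<subseteq> coord c ` cdom c" and lip: "K-lipschitz_on P (v c \<circ> cinv c)"
    and trap: "\<And>\<gamma> t s. \<lbrakk>curve {0..t} \<gamma>; \<gamma> 0 \<in> N; t \<le> \<tau>; s \<in> {0..t}\<rbrakk> \<Longrightarrow> \<gamma> s \<in> cdom c \<and> coord c (\<gamma> s) \<in> P"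
    using chart_trap[OF assms] by metis
  note ch = chart[OF c]
  have *: "openin (prod_topology X X) (N \<times> topspace X - {(y, z). \<exists>t\<in>T. flow X A v t y z})"
    if T: "compact T" "T \<subseteq> {0..\<tau>}" for T
  proof -
    define E where "E = {(p, q). \<exists>t\<in>T. \<exists>\<zeta>. \<zeta> 0 = p \<and> \<zeta> 1 = q \<and> (\<forall>s\<in>{0..1}. \<zeta> s \<in> P \<and>
      (\<zeta> has_vector_derivative t *\<^sub>R (v c \<circ> cinv c) (\<zeta> s)) (at s within {0..1::real}))}"
    have "closed E"
      unfolding E_def by (rule closed_solution_endpoints[OF P(1) lip T(1)])
    define D where "D = {x \<in> cdom c. coord c x \<in> P}"
    have "closedin X D"
      unfolding D_def by (rule compactin_imp_closedin[OF hausdorff compactin_coord_preimage[OF ch P]])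
    have iff: "(\<exists>t\<in>T. flow X A v t y z) \<longleftrightarrow> z \<in> cdom c \<and> (coord c y, coord c z) \<in> E"
      if "y \<in> N" for y z
    proof
      assume "\<exists>t\<in>T. flow X A v t y z"
      then obtain t \<gamma> where t: "t \<in> T" "curve {0..t} \<gamma>" "\<gamma> 0 = y" "\<gamma> t = z"
        by (auto simp: flow_def)
      have *: "\<gamma> s \<in> cdom c \<and> coord c (\<gamma> s) \<in> P" if "s \<in> {0..t}" for s
        using trap[OF t(2) _ _ that] t T(2) \<open>y \<in> N\<close> by auto
      have "0 \<le> t" using t(1) T(2) by auto
      then show "z \<in> cdom c \<and> (coord c y, coord c z) \<in> E"
        unfolding E_def using flow_coord[OF c t(2) *] t(1) *[of t] t(3,4) by auto
    next
      assume *: "z \<in> cdom c \<and> (coord c y, coord c z) \<in> E"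
      then obtain t \<zeta> where t: "t \<in> T" "\<zeta> 0 = coord c y" "\<zeta> 1 = coord c z"
        and \<zeta>: "\<forall>s\<in>{0..1}. \<zeta> s \<in> P \<and>
            (\<zeta> has_vector_derivative t *\<^sub>R (v c \<circ> cinv c) (\<zeta> s)) (at s within {0..1::real})"
        by (auto simp: E_def)
      have "flow X A v t (cinv c (coord c y)) (cinv c (coord c z))"
        using flow_cinv[OF c P(2) _ \<zeta>] t T(2) by auto
      then show "\<exists>t\<in>T. flow X A v t y z"
        using cinv_coord[OF ch] * that N(3) t(1) by (metis subsetD)
    qed
    have ED: "z \<in> D" if "z \<in> cdom c" "(p, coord c z) \<in> E" for p z
      using that by (auto simp: E_def D_def dest!: bspec[of _ _ 1])
    define W where "W = {yz \<in> cdom c \<times> cdom c. (coord c (fst yz), coord c (snd yz)) \<in> - E}"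
    have sub: "cdom c \<subseteq> topspace X" by (rule chart_on_props(2)[OF ch])
    have "openin (prod_topology X X) W"
    proof -
      let ?Z = "prod_topology (subtopology X (cdom c)) (subtopology X (cdom c))"
      have "continuous_map ?Z (prod_topology euclidean euclidean) (\<lambda>yz. (coord c (fst yz), coord c (snd yz)))"
        by (intro continuous_map_pairedI continuous_map_compose[unfolded o_def, OF continuous_map_fst]
            continuous_map_compose[unfolded o_def, OF continuous_map_snd] chart_on_props(5)[OF ch])
      then have "continuous_map ?Z euclidean (\<lambda>yz. (coord c (fst yz), coord c (snd yz)))"
        by (simp add: euclidean_product_topology)
      then have "openin ?Z {yz \<in> topspace ?Z. (coord c (fst yz), coord c (snd yz)) \<in> - E}"
        by (rule openin_continuous_map_preimage) (use \<open>closed E\<close> in auto)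
      moreover have "topspace ?Z = cdom c \<times> cdom c"
        using sub by auto
      ultimately have "openin ?Z W" by (simp add: W_def)
      moreover have "openin (prod_topology X X) (cdom c \<times> cdom c)"
        using chart_on_props(1)[OF ch] by (simp add: openin_prod_Times_iff)
      ultimately show ?thesis
        unfolding subtopology_Times[symmetric] by (rule openin_trans_full)
    qed
    \<comment> \<open>Over \<open>N\<close> the complement consists of the pairs in the chart with
      coordinates outside \<open>E\<close> and the pairs whose end point lies outside the closed set
      \<open>D\<close>, which no short flow from \<open>N\<close> leaves.\<close>
    then have "openin (prod_topology X X) (W \<inter> (N \<times> topspace X) \<union> N \<times> (topspace X - D))"
      using N(1) \<open>closedin X D\<close> by (intro openin_Un openin_Int) (auto simp: openin_prod_Times_iff)
    moreover have "W \<inter> (N \<times> topspace X) \<union> N \<times> (topspace X - D) =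
        N \<times> topspace X - {(y, z). \<exists>t\<in>T. flow X A v t y z}"
    proof -
      have "(y, z) \<in> W \<inter> (N \<times> topspace X) \<union> N \<times> (topspace X - D) \<longleftrightarrow>
          (y, z) \<in> N \<times> topspace X - {(y, z). \<exists>t\<in>T. flow X A v t y z}" for y z
      proof (cases "y \<in> N")
        case True
        have "z \<in> D \<longrightarrow> z \<in> cdom c" by (simp add: D_def)
        then show ?thesis
          using True N(3) ED[of z "coord c y"] by (simp add: iff W_def) blast
      qed simp
      then show ?thesis by (simp only: set_eq_iff split_paired_All simp_thms)
    qed
    ultimately show ?thesis by simp
  qed
  show thesis
  proof (rule that[OF N(1,2) \<open>0 < \<tau>\<close> *])
    fix t y z z' assume "flow X A v t y z" "flow X A v t y z'" "y \<in> N" "t \<le> \<tau>"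
    then obtain \<gamma> \<delta> where \<gamma>: "curve {0..t} \<gamma>" and \<delta>: "curve {0..t} \<delta>" and eq: "\<gamma> 0 = \<delta> 0"
      and N0: "\<gamma> 0 \<in> N" "t \<le> \<tau>" and ends: "\<gamma> t = z" "\<delta> t = z'"
      by (auto simp: flow_def)
    note T\<gamma> = trap[OF \<gamma> N0] and T\<delta> = trap[OF \<delta> N0[unfolded eq]]
    have "0 \<le> t" using \<gamma> by (simp add: integral_curve_def)
    have "(coord c \<circ> \<gamma>) t = (coord c \<circ> \<delta>) t"
    proof (rule lipschitz_ode_unique[OF lip \<open>0 \<le> t\<close>])
      fix s assume s: "s \<in> {0..t}"
      show "(coord c \<circ> \<gamma>) s \<in> P" "(coord c \<circ> \<delta>) s \<in> P"
        using T\<gamma> T\<delta> s by auto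
      show "((coord c \<circ> \<gamma>) has_vector_derivative (v c \<circ> cinv c) ((coord c \<circ> \<gamma>) s)) (at s within {0..t})"
        using curve_coord_derivative[OF \<gamma> s c] T\<gamma>[OF s] cinv_coord[OF ch] by simp
      show "((coord c \<circ> \<delta>) has_vector_derivative (v c \<circ> cinv c) ((coord c \<circ> \<delta>) s)) (at s within {0..t})"
        using curve_coord_derivative[OF \<delta> s c] T\<delta>[OF s] cinv_coord[OF ch] by simp
    qed (simp add: eq)
    then show "z = z'"
      using T\<gamma>[of t] T\<delta>[of t] \<open>0 \<le> t\<close> chart_on_props(3)[OF ch] ends by (auto simp: inj_on_def)
  qed auto
qed

lemma flow_topspace:
  assumes "flow X A v t x y"
  shows "x \<in> topspace X" "y \<in> topspace X" "0 \<le> t"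
proof -
  obtain \<gamma> where \<gamma>: "curve {0..t} \<gamma>" "\<gamma> 0 = x" "\<gamma> t = y"
    using assms by (auto simp: flow_def)
  then show "0 \<le> t" by (simp add: integral_curve_def)
  then show "x \<in> topspace X" "y \<in> topspace X"
    using curve_topspace[OF \<gamma>(1), of 0] curve_topspace[OF \<gamma>(1), of t] \<gamma> by auto
qed

lemma flow_split:
  assumes "flow X A v (s + t) x y" "0 \<le> s" "0 \<le> t"
  obtains z where "flow X A v s x z" "flow X A v t z y"
proof -
  obtain \<gamma> where \<gamma>: "curve {0..s + t} \<gamma>" "\<gamma> 0 = x" "\<gamma> (s + t) = y"
    using assms(1) by (auto simp: flow_def)
  have "curve {0..s} \<gamma>"
    by (rule integral_curve_subset[OF \<gamma>(1)]) (use assms in \<open>auto simp: is_interval_cc\<close>)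
  moreover have "curve {0..t} (\<lambda>u. \<gamma> (u + s))"
    by (rule integral_curve_shift[OF \<gamma>(1)]) (use assms in \<open>auto simp: is_interval_cc\<close>)
  ultimately have "flow X A v s x (\<gamma> s)" "flow X A v t (\<gamma> s) y"
    using \<gamma> unfolding flow_def by (auto simp: add.commute)
  then show thesis by (rule that)
qed

text \<open>By compactness finitely many of the local neighbourhoods cover \<open>X\<close>. The
  least of their times works for all of them, and their open sets unite to the complement of the
  relation.\<close>

lemma flow_uniform:
  obtains \<tau> where "0 < \<tau>"
    "\<And>T. \<lbrakk>compact T; T \<subseteq> {0..\<tau>}\<rbrakk> \<Longrightarrow> closedin (prod_topology X X) {(y, z). \<exists>t\<in>T. flow X A v t y z}"
    "\<And>t y z z'. \<lbrakk>flow X A v t y z; flow X A v t y z'; t \<le> \<tau>\<rbrakk> \<Longrightarrow> z = z'"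
proof -
  define Q where "Q N \<tau> \<longleftrightarrow>
    (\<forall>T. compact T \<and> T \<subseteq> {0..\<tau>} \<longrightarrow>
      openin (prod_topology X X) (N \<times> topspace X - {(y, z). \<exists>t\<in>T. flow X A v t y z})) \<and>
    (\<forall>t y z z'. flow X A v t y z \<and> flow X A v t y z' \<and> y \<in> N \<and> t \<le> \<tau> \<longrightarrow> z = z')"
    for N and \<tau> :: real
  define \<N> where "\<N> = {N. openin X N \<and> (\<exists>\<tau>>0. Q N \<tau>)}"
  have "\<exists>N\<in>\<N>. x \<in> N" if x: "x \<in> topspace X" for x
  proof -
    obtain N \<tau> where "openin X N" "x \<in> N" "0 < \<tau>" "Q N \<tau>"
      by (rule flow_local[OF x], rule that) (auto simp: Q_def)
    then show ?thesis unfolding \<N>_def by blast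
  qed
  then have "topspace X \<subseteq> \<Union>\<N>" by blast
  moreover have "\<forall>N\<in>\<N>. openin X N" by (simp add: \<N>_def)
  ultimately have "\<exists>\<F>. finite \<F> \<and> \<F> \<subseteq> \<N> \<and> topspace X \<subseteq> \<Union>\<F>"
    using compact[unfolded compact_space_alt, THEN spec, of \<N>] by simp
  then obtain \<F> where \<F>: "finite \<F>" "\<F> \<subseteq> \<N>" "topspace X \<subseteq> \<Union>\<F>"
    by blast
  have "\<exists>\<tau>>0. \<forall>N\<in>\<F>. Q N \<tau>"
  proof (rule finite_uniform_bound[OF \<F>(1)])
    show "\<exists>\<tau>>0. Q N \<tau>" if "N \<in> \<F>" for N
      using that \<F>(2) by (auto simp: \<N>_def)
    show "Q N \<sigma>" if "Q N \<tau>" "0 < \<sigma>" "\<sigma> \<le> \<tau>" for N \<sigma> \<tau>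
    proof -
      have "{0..\<sigma>} \<subseteq> {0..\<tau>}"
        using \<open>\<sigma> \<le> \<tau>\<close> by simp
      then have "T \<subseteq> {0..\<tau>}" if "T \<subseteq> {0..\<sigma>}" for T
        using that by (rule subset_trans[rotated])
      moreover have "t \<le> \<tau>" if "t \<le> \<sigma>" for t
        using that \<open>\<sigma> \<le> \<tau>\<close> by simp
      ultimately show ?thesis
        using \<open>Q N \<tau>\<close> by (simp add: Q_def) metis
    qed
  qed
  then obtain \<tau> where "\<tau> > 0" and \<tau>: "\<And>N. N \<in> \<F> \<Longrightarrow> Q N \<tau>" by blast
  show thesis
  proof (rule that[OF \<open>\<tau> > 0\<close>])
    fix T assume T: "compact T" "T \<subseteq> {0..\<tau>}"
    let ?R = "{(y, z). \<exists>t\<in>T. flow X A v t y z}"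
    have "?R \<subseteq> topspace (prod_topology X X)"
      using flow_topspace by auto
    moreover have "openin (prod_topology X X) (\<Union>N\<in>\<F>. N \<times> topspace X - ?R)"
      using \<tau> T by (intro openin_Union) (auto simp: Q_def)
    moreover have "(\<Union>N\<in>\<F>. N \<times> topspace X - ?R) = topspace (prod_topology X X) - ?R"
    proof -
      have "N \<subseteq> topspace X" if "N \<in> \<F>" for N
        using that \<F>(2) openin_subset by (auto simp: \<N>_def)
      then have "(\<Union>N\<in>\<F>. N \<times> topspace X) = topspace X \<times> topspace X"
        using \<F>(3) by blast
      then show ?thesis by auto
    qed
    ultimately show "closedin (prod_topology X X) ?R"
      by (simp add: closedin_def)
  next
    fix t y z z' assume *: "flow X A v t y z" "flow X A v t y z'" "t \<le> \<tau>"
    then obtain N where "N \<in> \<F>" "y \<in> N"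
      using flow_topspace(1)[OF *(1)] \<F>(3) by auto
    then show "z = z'"
      using \<tau>[of N] * unfolding Q_def by blast
  qed
qed

text \<open>Short-time uniqueness is iterated: cut both curves at time \<open>\<tau>\<close>, where
  they agree, and continue from the common point.\<close>

lemma flow_unique:
  assumes "flow X A v t x y" "flow X A v t x y'"
  shows "y = y'"
proof -
  obtain \<tau> where "\<tau> > 0"
    and \<tau>: "\<And>t y z z'. \<lbrakk>flow X A v t y z; flow X A v t y z'; t \<le> \<tau>\<rbrakk> \<Longrightarrow> z = z'"
    by (rule flow_uniform) blast
  have "y = y'" if "t \<le> real n * \<tau>" for n
    using assms that
  proof (induction n arbitrary: t x)
    case 0
    then show ?case using \<tau>[OF 0(1,2)] \<open>\<tau> > 0\<close> by simp
  next
    case (Suc n)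
    show ?case
    proof (cases "t \<le> \<tau>")
      case True
      then show ?thesis using \<tau>[OF Suc.prems(1,2)] by simp
    next
      case False
      have t: "t = \<tau> + (t - \<tau>)" "0 \<le> \<tau>" "0 \<le> t - \<tau>"
        using False \<open>\<tau> > 0\<close> by auto
      obtain z where z: "flow X A v \<tau> x z" "flow X A v (t - \<tau>) z y"
        using flow_split[of \<tau> "t - \<tau>" x y] Suc.prems(1) t by auto
      obtain z' where z': "flow X A v \<tau> x z'" "flow X A v (t - \<tau>) z' y'"
        using flow_split[of \<tau> "t - \<tau>" x y'] Suc.prems(2) t by auto
      have "z = z'" using \<tau>[OF z(1) z'(1)] by simp
      then show ?thesis
        using Suc.IH[OF z(2)] z'(2) Suc.prems(3) by (simp add: algebra_simps)
    qed
  qed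
  moreover obtain n :: nat where "t < real n * \<tau>"
    using reals_Archimedean3[OF \<open>\<tau> > 0\<close>] by auto
  ultimately show ?thesis by (metis less_imp_le)
qed

lemma compact_vfield_uminus: "compact_vfield X A (\<lambda>c x. - v c x)"
proof
  fix c d x assume c: "c \<in> A" "d \<in> A" "x \<in> cdom c \<inter> cdom d"
  then obtain D where D: "((coord d \<circ> cinv c) has_derivative D) (at (coord c x) within coord c ` (cdom c \<inter> cdom d))"
    "D (v c x) = v d x" using change by blast
  then show "\<exists>D. ((coord d \<circ> cinv c) has_derivative D) (at (coord c x) within coord c ` (cdom c \<inter> cdom d)) \<and>
      D (- v c x) = - v d x"
    by (intro exI[of _ D]) (simp add: linear_neg has_derivative_linear)
next
  fix c x assume "c \<in> A" "x \<in> cdom c"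
  from lipschitz[OF this]
  show "\<exists>r>0. \<exists>K. cball (coord c x) r \<inter> half_space \<subseteq> coord c ` cdom c \<and>
        K-lipschitz_on (cball (coord c x) r \<inter> half_space) ((\<lambda>x. - v c x) \<circ> cinv c)"
    by (simp add: lipschitz_on_def o_def)
qed (use hausdorff compact chart cover in auto)

text \<open>After \<open>s\<close> this is uniqueness of the flow; before \<open>s\<close>,
  reversing time turns the curves into curves of the negative field.\<close>

lemma curve_unique:
  assumes \<gamma>: "curve I \<gamma>" and \<delta>: "curve J \<delta>" and s: "s \<in> I \<inter> J" "\<gamma> s = \<delta> s" and t: "t \<in> I \<inter> J"
  shows "\<gamma> t = \<delta> t"
proof -
  have I: "is_interval (I \<inter> J)"
    using \<gamma> \<delta> by (simp add: integral_curve_def is_interval_Int)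
  have \<gamma>': "curve (I \<inter> J) \<gamma>" and \<delta>': "curve (I \<inter> J) \<delta>"
    using integral_curve_subset[OF \<gamma> I] integral_curve_subset[OF \<delta> I] s(1) by auto
  show ?thesis
  proof (cases "s \<le> t")
    case True
    have *: "u + s \<in> I \<inter> J" if "u \<in> {0..t - s}" for u
      by (rule mem_is_interval_1_I[OF I s(1) t]) (use that in auto)
    have "curve {0..t - s} (\<lambda>u. \<gamma> (u + s))"
      by (rule integral_curve_shift[OF \<gamma>' _ _ *]) (use True in \<open>auto simp: is_interval_cc\<close>)
    then have "flow X A v (t - s) (\<gamma> s) (\<gamma> t)"
      unfolding flow_def by (intro exI[of _ "\<lambda>u. \<gamma> (u + s)"]) simp
    moreover have "curve {0..t - s} (\<lambda>u. \<delta> (u + s))"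
      by (rule integral_curve_shift[OF \<delta>' _ _ *]) (use True in \<open>auto simp: is_interval_cc\<close>)
    then have "flow X A v (t - s) (\<delta> s) (\<delta> t)"
      unfolding flow_def by (intro exI[of _ "\<lambda>u. \<delta> (u + s)"]) simp
    ultimately show ?thesis
      using s(2) flow_unique by simp
  next
    case False
    interpret neg: compact_vfield X A "\<lambda>c x. - v c x"
      by (rule compact_vfield_uminus)
    have *: "- 1 * u + s \<in> I \<inter> J" if "u \<in> {0..s - t}" for u
      by (rule mem_is_interval_1_I[OF I t s(1)]) (use that in auto)
    have "integral_curve X A (\<lambda>c x. (- 1) *\<^sub>R v c x) {0..s - t} (\<lambda>u. \<gamma> (- 1 * u + s))"
      by (rule integral_curve_affine[OF \<gamma>' _ _ *]) (use False in \<open>auto simp: is_interval_cc\<close>)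
    moreover have "integral_curve X A (\<lambda>c x. (- 1) *\<^sub>R v c x) {0..s - t} (\<lambda>u. \<delta> (- 1 * u + s))"
      by (rule integral_curve_affine[OF \<delta>' _ _ *]) (use False in \<open>auto simp: is_interval_cc\<close>)
    ultimately have "neg.curve {0..s - t} (\<lambda>u. \<gamma> (s - u))" "neg.curve {0..s - t} (\<lambda>u. \<delta> (s - u))"
      by simp_all
    then have "flow X A (\<lambda>c x. - v c x) (s - t) (\<gamma> s) (\<gamma> t)" "flow X A (\<lambda>c x. - v c x) (s - t) (\<delta> s) (\<delta> t)"
      unfolding flow_def
      by (intro exI[of _ "\<lambda>u. \<gamma> (s - u)"] exI[of _ "\<lambda>u. \<delta> (s - u)"]; simp)+
    then show ?thesis
      using s(2) neg.flow_unique by simp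
  qed
qed

end

section \<open>Reachability, maximal curves and leaves as equivalence classes\<close>

text \<open>The composition is the projection of a closed set of triples along the middle factor
  \<open>Y\<close>, and projection along a compact factor is a closed map.\<close>

lemma closedin_relcomp:
  assumes "compact_space Y" "closedin (prod_topology X Y) R" "closedin (prod_topology Y Z) S"
  shows "closedin (prod_topology X Z) (R O S)"
proof -
  let ?P = "prod_topology Y (prod_topology X Z)"
  have "continuous_map ?P (prod_topology X Y) (\<lambda>p. (fst (snd p), fst p))"
    "continuous_map ?P (prod_topology Y Z) (\<lambda>p. (fst p, snd (snd p)))"
    by (intro continuous_map_pairedI continuous_map_fst continuous_map_snd
        continuous_map_compose[OF continuous_map_snd continuous_map_fst, unfolded o_def]
        continuous_map_compose[OF continuous_map_snd continuous_map_snd, unfolded o_def])+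
  then have "closedin ?P {p \<in> topspace ?P. (fst (snd p), fst p) \<in> R}"
    "closedin ?P {p \<in> topspace ?P. (fst p, snd (snd p)) \<in> S}"
    using assms closedin_continuous_map_preimage by blast+
  then have "closedin ?P ({p \<in> topspace ?P. (fst (snd p), fst p) \<in> R} \<inter>
      {p \<in> topspace ?P. (fst p, snd (snd p)) \<in> S})" (is "closedin _ ?C")
    by (rule closedin_Int)
  moreover have "snd ` ?C = R O S"
  proof (intro set_eqI iffI)
    fix q assume "q \<in> R O S"
    then obtain x y z where q: "q = (x, z)" "(x, y) \<in> R" "(y, z) \<in> S" by auto
    then have "x \<in> topspace X" "y \<in> topspace Y" "z \<in> topspace Z"
      using closedin_subset[OF assms(2)] closedin_subset[OF assms(3)] by auto
    then have "(y, q) \<in> ?C" using q by simp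
    then show "q \<in> snd ` ?C" by (rule image_eqI[rotated]) simp
  qed auto
  ultimately show ?thesis
    using closed_map_snd[OF assms(1), of "prod_topology X Z"] unfolding closed_map_def by auto
qed

definition reachable ::
    "'a topology \<Rightarrow> ('a, 'e::euclidean_space) chart set \<Rightarrow> ('a, 'e) vfield \<Rightarrow> 'a \<Rightarrow> 'a \<Rightarrow> bool" where
  "reachable X A v x y \<longleftrightarrow> (\<exists>t. flow X A v t x y)"

text \<open>This turns out to be the relation of lying on one leaf. Symmetry is built in;
  transitivity has to wait for maximal curves.\<close>

definition linked ::
    "'a topology \<Rightarrow> ('a, 'e::euclidean_space) chart set \<Rightarrow> ('a, 'e) vfield \<Rightarrow> 'a \<Rightarrow> 'a \<Rightarrow> bool" where
  "linked X A v x y \<longleftrightarrow> reachable X A v x y \<or> reachable X A v y x"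

context compact_vfield
begin

abbreviation reach :: "'a \<Rightarrow> 'a \<Rightarrow> bool" where "reach \<equiv> reachable X A v"
abbreviation link :: "'a \<Rightarrow> 'a \<Rightarrow> bool" where "link \<equiv> linked X A v"

text \<open>On either side of the common time \<open>s\<close> one interval contains the other, so
  each half of the union lies in a single curve; the halves are joined at \<open>s\<close>.\<close>

lemma curve_Un:
  assumes \<gamma>: "curve I \<gamma>" "curve J \<gamma>" and s: "s \<in> I" "s \<in> J"
  shows "curve (I \<union> J) \<gamma>"
proof -
  have int: "is_interval I" "is_interval J"
    using \<gamma> by (auto simp: integral_curve_def)
  have lower: "I \<inter> {..s} \<subseteq> J \<or> J \<inter> {..s} \<subseteq> I"
  proof (rule ccontr)
    assume "\<not> ?thesis"
    then obtain a b where ab: "a \<in> I" "a \<le> s" "a \<notin> J" "b \<in> J" "b \<le> s" "b \<notin> I" by auto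
    then show False
      using mem_is_interval_1_I[OF int(1) ab(1) s(1), of b] mem_is_interval_1_I[OF int(2) ab(4) s(2), of a]
      by linarith
  qed
  have upper: "I \<inter> {s..} \<subseteq> J \<or> J \<inter> {s..} \<subseteq> I"
  proof (rule ccontr)
    assume "\<not> ?thesis"
    then obtain a b where ab: "a \<in> I" "s \<le> a" "a \<notin> J" "b \<in> J" "s \<le> b" "b \<notin> I" by auto
    then show False
      using mem_is_interval_1_I[OF int(1) s(1) ab(1), of b] mem_is_interval_1_I[OF int(2) s(2) ab(4), of a]
      by linarith
  qed
  have half: "curve ((I \<union> J) \<inter> H) \<gamma>"
    if H: "is_interval H" "s \<in> H" "I \<inter> H \<subseteq> J \<or> J \<inter> H \<subseteq> I" for H
  proof -
    have "(I \<union> J) \<inter> H = I \<inter> H \<or> (I \<union> J) \<inter> H = J \<inter> H"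
      using H(3) by blast
    moreover have "curve (I \<inter> H) \<gamma>" "curve (J \<inter> H) \<gamma>"
      using integral_curve_subset[OF \<gamma>(1) is_interval_Int[OF int(1) H(1)]]
        integral_curve_subset[OF \<gamma>(2) is_interval_Int[OF int(2) H(1)]] s H(2) by auto
    ultimately show ?thesis by auto
  qed
  have "curve ((I \<union> J) \<inter> {..s} \<union> (I \<union> J) \<inter> {s..}) (\<lambda>t. if t \<le> s then \<gamma> t else \<gamma> t)"
    by (rule integral_curve_concat[OF half[OF _ _ lower] half[OF _ _ upper]])
      (use s in \<open>auto simp: is_interval_1\<close>)
  moreover have "(I \<union> J) \<inter> {..s} \<union> (I \<union> J) \<inter> {s..} = I \<union> J" by auto
  ultimately show ?thesis by simp
qed

lemma curve_Union:
  assumes "\<And>J. J \<in> \<J> \<Longrightarrow> curve J \<gamma>" "\<And>J. J \<in> \<J> \<Longrightarrow> s \<in> J" "\<J> \<noteq> {}"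
  shows "curve (\<Union>\<J>) \<gamma>"
proof (rule integral_curve_local)
  have int: "is_interval J" if "J \<in> \<J>" for J
    using assms(1)[OF that] by (simp add: integral_curve_def)
  then show "is_interval (\<Union>\<J>)"
    unfolding is_interval_connected_1 by (intro connected_Union) (use assms(2) in blast)+
  show "\<Union>\<J> \<noteq> {}" using assms(2,3) by auto
  fix t assume t: "t \<in> \<Union>\<J>"
  then obtain J0 where J0: "J0 \<in> \<J>" "t \<in> J0" by auto
  \<comment> \<open>\<open>J0\<close> may end at \<open>t\<close> while the union goes on.
    \<open>J1\<close> and \<open>J2\<close> pass \<open>t\<close> on the left and on the right
    whenever the union does, so the three together form a neighbourhood of \<open>t\<close> in the
    union.\<close>
  obtain J1 where J1: "J1 \<in> \<J>" "(\<exists>a\<in>\<Union>\<J>. a < t) \<Longrightarrow> \<exists>a\<in>J1. a < t"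
    using J0(1) by (cases "\<exists>a\<in>\<Union>\<J>. a < t") auto
  obtain J2 where J2: "J2 \<in> \<J>" "(\<exists>b\<in>\<Union>\<J>. t < b) \<Longrightarrow> \<exists>b\<in>J2. t < b"
    using J0(1) by (cases "\<exists>b\<in>\<Union>\<J>. t < b") auto
  let ?J = "J0 \<union> J1 \<union> J2"
  have J: "curve ?J \<gamma>"
    using curve_Un[OF curve_Un[OF assms(1)[OF J0(1)] assms(1)[OF J1(1)]] assms(1)[OF J2(1)], of s s]
      assms(2) J0(1) J1(1) J2(1) by simp
  then have "is_interval ?J" by (simp add: integral_curve_def)
  obtain S1 where S1: "open S1" "t \<in> S1" "\<And>u. u \<in> \<Union>\<J> \<inter> S1 \<Longrightarrow> u \<le> t \<Longrightarrow> u \<in> ?J"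
  proof (cases "\<exists>a\<in>\<Union>\<J>. a < t")
    case True
    then obtain a where "a \<in> J1" "a < t" using J1(2) by auto
    then show thesis
      using mem_is_interval_1_I[OF \<open>is_interval ?J\<close>, of a t] J0(2) by (intro that[of "{a<..}"]) auto
  next
    case False
    then have "u = t" if "u \<in> \<Union>\<J>" "u \<le> t" for u
      using that by (meson less_le)
    then show thesis using J0(2) by (intro that[of UNIV]) auto
  qed
  obtain S2 where S2: "open S2" "t \<in> S2" "\<And>u. u \<in> \<Union>\<J> \<inter> S2 \<Longrightarrow> t \<le> u \<Longrightarrow> u \<in> ?J"
  proof (cases "\<exists>b\<in>\<Union>\<J>. t < b")
    case True
    then obtain b where "b \<in> J2" "t < b" using J2(2) by auto
    then show thesis
      using mem_is_interval_1_I[OF \<open>is_interval ?J\<close>, of t b] J0(2) by (intro that[of "{..<b}"]) auto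
  next
    case False
    then have "u = t" if "u \<in> \<Union>\<J>" "t \<le> u" for u
      using that by (metis less_le)
    then show thesis using J0(2) by (intro that[of UNIV]) auto
  qed
  have "\<Union>\<J> \<inter> (S1 \<inter> S2) \<subseteq> ?J"
  proof
    fix u assume "u \<in> \<Union>\<J> \<inter> (S1 \<inter> S2)"
    then show "u \<in> ?J"
      using S1(3)[of u] S2(3)[of u] linear[of u t] by blast
  qed
  then show "\<exists>S J. open S \<and> t \<in> S \<and> t \<in> J \<and> \<Union>\<J> \<inter> S \<subseteq> J \<and> J \<subseteq> \<Union>\<J> \<and> curve J \<gamma>"
    using S1 S2 J J0 J1(1) J2(1)
    by (intro exI[of _ "S1 \<inter> S2"] exI[of _ ?J]) auto
qed

text \<open>By uniqueness all curves that agree with \<open>\<delta>\<close> at \<open>s\<close>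
  agree with each other wherever both are defined. Their union is thus a single curve, the largest
  one; no Zorn argument is involved.\<close>

lemma curve_extends:
  assumes \<delta>: "curve J \<delta>"
  obtains I \<gamma> where "maximal_integral_curve X A v I \<gamma>" "J \<subseteq> I" "\<forall>t\<in>J. \<gamma> t = \<delta> t"
proof -
  obtain s where s: "s \<in> J" using \<delta> by (auto simp: integral_curve_def)
  define ext where "ext K \<epsilon> \<longleftrightarrow> curve K \<epsilon> \<and> s \<in> K \<and> \<epsilon> s = \<delta> s" for K \<epsilon>
  define \<gamma> where "\<gamma> t = (SOME y. \<exists>K \<epsilon>. ext K \<epsilon> \<and> t \<in> K \<and> \<epsilon> t = y)" for t
  have agree: "\<gamma> t = \<epsilon> t" if "ext K \<epsilon>" "t \<in> K" for K \<epsilon> t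
  proof -
    have "\<exists>y K \<epsilon>. ext K \<epsilon> \<and> t \<in> K \<and> \<epsilon> t = y" using that by blast
    then have "\<exists>K \<epsilon>. ext K \<epsilon> \<and> t \<in> K \<and> \<epsilon> t = \<gamma> t"
      unfolding \<gamma>_def by (rule someI_ex)
    then obtain K' \<epsilon>' where K': "ext K' \<epsilon>'" "t \<in> K'" "\<epsilon>' t = \<gamma> t" by blast
    have "\<epsilon>' t = \<epsilon> t"
      by (rule curve_unique[of K' \<epsilon>' K \<epsilon> s]) (use K' that in \<open>auto simp: ext_def\<close>)
    then show ?thesis using K' by simp
  qed
  define \<J> where "\<J> = {K. \<exists>\<epsilon>. ext K \<epsilon>}"
  have \<J>: "curve K \<gamma>" "s \<in> K" if K: "K \<in> \<J>" for K
  proof -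
    obtain \<epsilon> where \<epsilon>: "ext K \<epsilon>" using K by (auto simp: \<J>_def)
    then have "curve K \<epsilon>" by (simp add: ext_def)
    then show "curve K \<gamma>" by (rule integral_curve_cong) (rule agree[OF \<epsilon>])
    show "s \<in> K" using \<epsilon> by (simp add: ext_def)
  qed
  have J: "ext J \<delta>" using \<delta> s by (simp add: ext_def)
  then have "J \<in> \<J>" by (auto simp: \<J>_def)
  have c: "curve (\<Union>\<J>) \<gamma>"
    by (rule curve_Union[of \<J> \<gamma> s]) (use \<J> \<open>J \<in> \<J>\<close> in auto)
  have "maximal_integral_curve X A v (\<Union>\<J>) \<gamma>"
    unfolding maximal_integral_curve_def
  proof (intro conjI allI impI c)
    fix K \<epsilon> assume K: "curve K \<epsilon> \<and> \<Union>\<J> \<subseteq> K \<and> (\<forall>t\<in>\<Union>\<J>. \<epsilon> t = \<gamma> t)"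
    then have "s \<in> K" "\<epsilon> s = \<gamma> s" using s \<open>J \<in> \<J>\<close> by auto
    then have "ext K \<epsilon>" using K agree[OF J s] by (simp add: ext_def)
    then have "K \<in> \<J>" by (auto simp: \<J>_def)
    then show "K = \<Union>\<J>" using K by blast
  qed
  then show thesis
    by (rule that) (use \<open>J \<in> \<J>\<close> agree[OF J] in auto)
qed

text \<open>Shift \<open>\<delta>\<close> so that the curves meet at the same time \<open>s\<close>.
  Their union is an integral curve extending \<open>\<gamma>\<close>, and maximality says that it is
  no longer than \<open>\<gamma>\<close>.\<close>

lemma maximal_curve_absorbs:
  assumes max: "maximal_integral_curve X A v I \<gamma>" and \<delta>: "curve J \<delta>"
    and s: "s \<in> I" "t \<in> J" "\<gamma> s = \<delta> t" and u: "u \<in> J"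
  shows "u - t + s \<in> I" "\<gamma> (u - t + s) = \<delta> u"
proof -
  have \<gamma>: "curve I \<gamma>" using max by (simp add: maximal_integral_curve_def)
  define J' where "J' = {r. r + (t - s) \<in> J}"
  define \<delta>' where "\<delta>' r = \<delta> (r + (t - s))" for r
  have "is_interval J" using \<delta> by (simp add: integral_curve_def)
  then have "is_interval J'"
    unfolding is_interval_1 J'_def by (smt (verit) mem_Collect_eq)
  have \<delta>': "curve J' \<delta>'"
    unfolding \<delta>'_def
    by (rule integral_curve_shift[OF \<delta> \<open>is_interval J'\<close>]) (use s in \<open>auto simp: J'_def intro!: exI[of _ s]\<close>)
  have sJ': "s \<in> J'" "\<delta>' s = \<gamma> s" using s by (auto simp: J'_def \<delta>'_def)
  define \<zeta> where "\<zeta> r = (if r \<in> I then \<gamma> r else \<delta>' r)" for r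
  have \<zeta>\<delta>: "\<zeta> r = \<delta>' r" if "r \<in> J'" for r
    using curve_unique[OF \<gamma> \<delta>', of s r] s sJ' that by (auto simp: \<zeta>_def)
  have "curve I \<zeta>"
    by (rule integral_curve_cong[OF \<gamma>]) (simp add: \<zeta>_def)
  moreover have "curve J' \<zeta>"
    by (rule integral_curve_cong[OF \<delta>' \<zeta>\<delta>])
  ultimately have "curve (I \<union> J') \<zeta>"
    by (rule curve_Un[OF _ _ s(1) sJ'(1)])
  then have "I \<union> J' = I"
    using max[unfolded maximal_integral_curve_def, THEN conjunct2, rule_format, of "I \<union> J'" \<zeta>]
    by (simp add: \<zeta>_def)
  moreover have uJ': "u - t + s \<in> J'" using u by (simp add: J'_def)
  ultimately show "u - t + s \<in> I" by blast
  then show "\<gamma> (u - t + s) = \<delta> u"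
    using \<zeta>\<delta>[OF uJ'] by (simp add: \<zeta>_def \<delta>'_def)
qed

lemma curve_flow:
  assumes \<gamma>: "curve I \<gamma>" and "s \<in> I" "t \<in> I" "s \<le> t"
  shows "flow X A v (t - s) (\<gamma> s) (\<gamma> t)"
proof -
  have I: "is_interval I" using \<gamma> by (simp add: integral_curve_def)
  have *: "u + s \<in> I" if "u \<in> {0..t - s}" for u
    by (rule mem_is_interval_1_I[OF I assms(2,3)]) (use that in auto)
  have "curve {0..t - s} (\<lambda>u. \<gamma> (u + s))"
    by (rule integral_curve_shift[OF \<gamma> _ _ *]) (use \<open>s \<le> t\<close> in \<open>auto simp: is_interval_cc\<close>)
  then show ?thesis
    unfolding flow_def by (intro exI[of _ "\<lambda>u. \<gamma> (u + s)"]) simp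
qed

lemma flow_trans:
  assumes "flow X A v s x z" "flow X A v t z y"
  shows "flow X A v (s + t) x y"
proof -
  obtain \<gamma> \<delta> where \<gamma>: "curve {0..s} \<gamma>" "\<gamma> 0 = x" "\<gamma> s = z" and \<delta>: "curve {0..t} \<delta>" "\<delta> 0 = z" "\<delta> t = y"
    using assms by (auto simp: flow_def)
  have st: "0 \<le> s" "0 \<le> t" using assms flow_topspace(3) by auto
  have "curve {s..s + t} (\<lambda>u. \<delta> (u + - s))"
    by (rule integral_curve_shift[OF \<delta>(1)]) (use st in \<open>auto simp: is_interval_cc\<close>)
  from integral_curve_concat[OF \<gamma>(1) this, of s]
  have "curve ({0..s} \<union> {s..s + t}) (\<lambda>u. if u \<le> s then \<gamma> u else \<delta> (u + - s))"
    using \<gamma>(3) \<delta>(2) st by simp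
  moreover have "{0..s} \<union> {s..s + t} = {0..s + t}"
    using st by auto
  ultimately show ?thesis
    unfolding flow_def using \<gamma> \<delta> st
    by (intro exI[of _ "\<lambda>u. if u \<le> s then \<gamma> u else \<delta> (u + - s)"]) auto
qed

lemma flowE:
  assumes "flow X A v t x y"
  obtains \<gamma> where "curve {0..t} \<gamma>" "\<gamma> 0 = x" "\<gamma> t = y" "0 \<le> t"
  using assms flow_topspace(3)[OF assms] by (auto simp: flow_def)

lemma flow_refl: "x \<in> topspace X \<Longrightarrow> flow X A v 0 x x"
  using integral_curve_const[of x X A v 0] by (auto simp: flow_def)

lemma reach_trans: "reach x y \<Longrightarrow> reach y z \<Longrightarrow> reach x z"
  unfolding reachable_def using flow_trans by blast

lemma reach_topspace: "reach x y \<Longrightarrow> x \<in> topspace X \<and> y \<in> topspace X"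
  unfolding reachable_def using flow_topspace(1,2) by blast

lemma link_sym: "link x y \<Longrightarrow> link y x"
  by (auto simp: linked_def)

lemma link_refl: "x \<in> topspace X \<Longrightarrow> link x x"
  unfolding linked_def reachable_def using flow_refl by blast

lemma link_topspace: "link x y \<Longrightarrow> x \<in> topspace X \<and> y \<in> topspace X"
  unfolding linked_def using reach_topspace by blast

text \<open>Any curve meeting a maximal one is absorbed by it. As \<open>s\<close> is an arbitrary
  time, the same set is the class of each of its points, and transitivity of \<open>link\<close>
  follows.\<close>

lemma maximal_curve_image:
  assumes max: "maximal_integral_curve X A v I \<gamma>" and s: "s \<in> I"
  shows "\<gamma> ` I = {y. link (\<gamma> s) y}"
proof (intro equalityI subsetI)
  have \<gamma>: "curve I \<gamma>" using max by (simp add: maximal_integral_curve_def)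
  fix y assume "y \<in> \<gamma> ` I"
  then obtain u where "u \<in> I" "y = \<gamma> u" by blast
  then show "y \<in> {y. link (\<gamma> s) y}"
    using curve_flow[OF \<gamma> s, of u] curve_flow[OF \<gamma> _ s, of u]
    by (cases "s \<le> u") (auto simp: linked_def reachable_def)
next
  fix y assume "y \<in> {y. link (\<gamma> s) y}"
  then consider t where "flow X A v t (\<gamma> s) y" | t where "flow X A v t y (\<gamma> s)"
    by (auto simp: linked_def reachable_def)
  then show "y \<in> \<gamma> ` I"
  proof cases
    case 1
    then obtain \<delta> where \<delta>: "curve {0..t} \<delta>" "\<delta> 0 = \<gamma> s" "\<delta> t = y" and "0 \<le> t"
      by (rule flowE)
    then show ?thesis
      using maximal_curve_absorbs[OF max \<delta>(1) s(1), of 0 t]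
      by (intro image_eqI[of _ _ "t - 0 + s"]) simp_all
  next
    case 2
    then obtain \<delta> where \<delta>: "curve {0..t} \<delta>" "\<delta> 0 = y" "\<delta> t = \<gamma> s" and "0 \<le> t"
      by (rule flowE)
    then show ?thesis
      using maximal_curve_absorbs[OF max \<delta>(1) s(1), of t 0]
      by (intro image_eqI[of _ _ "0 - t + s"]) simp_all
  qed
qed

lemma maximal_curve_through:
  assumes "x \<in> topspace X"
  obtains I \<gamma> s where "maximal_integral_curve X A v I \<gamma>" "s \<in> I" "\<gamma> s = x"
proof (rule curve_extends[OF integral_curve_const[OF assms, of A v 0]])
  fix I \<gamma> assume max: "maximal_integral_curve X A v I \<gamma>"
    and "{0} \<subseteq> I" "\<forall>t\<in>{0}. \<gamma> t = x"
  then have "0 \<in> I" "\<gamma> 0 = x" by auto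
  with max show thesis by (rule that)
qed

lemma trajectories_eq: "trajectories X A v = {{y. link x y} |x. x \<in> topspace X}"
proof (intro equalityI subsetI)
  fix L assume "L \<in> trajectories X A v"
  then obtain I \<gamma> where L: "L = \<gamma> ` I" and max: "maximal_integral_curve X A v I \<gamma>"
    by (auto simp: trajectories_def)
  then have "curve I \<gamma>" by (simp add: maximal_integral_curve_def)
  moreover then obtain s where s: "s \<in> I" by (auto simp: integral_curve_def)
  ultimately show "L \<in> {{y. link x y} |x. x \<in> topspace X}"
    using maximal_curve_image[OF max s] L curve_topspace[of I \<gamma> s] by auto
next
  fix L assume "L \<in> {{y. link x y} |x. x \<in> topspace X}"
  then obtain x where L: "L = {y. link x y}" and "x \<in> topspace X" by blast
  from this(2) obtain I \<gamma> s where max: "maximal_integral_curve X A v I \<gamma>" and s: "s \<in> I" "\<gamma> s = x"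
    by (rule maximal_curve_through)
  then show "L \<in> trajectories X A v"
    using maximal_curve_image[OF max s(1)] L by (auto simp: trajectories_def)
qed

lemma link_trans:
  assumes "link x y" "link y z"
  shows "link x z"
proof -
  have "x \<in> topspace X" using link_topspace[OF assms(1)] by simp
  then obtain I \<gamma> s where max: "maximal_integral_curve X A v I \<gamma>" and s: "s \<in> I" "\<gamma> s = x"
    by (rule maximal_curve_through)
  then have "y \<in> \<gamma> ` I" using maximal_curve_image[OF max s(1)] assms(1) by simp
  then obtain u where u: "u \<in> I" "\<gamma> u = y" by blast
  then have "z \<in> \<gamma> ` I" using maximal_curve_image[OF max u(1)] assms(2) by simp
  then show ?thesis using maximal_curve_image[OF max s(1)] s(2) by simp
qed

text \<open>Every flow segment extends to a maximal curve. From here on leaves and their orientation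
  are expressed by \<open>link\<close> and \<open>reach\<close>, without reference to maximal
  curves.\<close>

lemma trajectory_order_iff: "(x, y) \<in> trajectory_order X A v \<longleftrightarrow> reach x y"
proof
  assume "(x, y) \<in> trajectory_order X A v"
  then obtain I \<gamma> s t where max: "maximal_integral_curve X A v I \<gamma>"
    and *: "s \<in> I" "t \<in> I" "s \<le> t" "x = \<gamma> s" "y = \<gamma> t"
    by (auto simp: trajectory_order_def)
  then have "curve I \<gamma>" by (simp add: maximal_integral_curve_def)
  from curve_flow[OF this *(1-3)] show "reach x y"
    using * by (auto simp: reachable_def)
next
  assume "reach x y"
  then obtain t where "flow X A v t x y" by (auto simp: reachable_def)
  then obtain \<delta> where \<delta>: "curve {0..t} \<delta>" "\<delta> 0 = x" "\<delta> t = y" and "0 \<le> t"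
    by (rule flowE)
  obtain I \<gamma> where max: "maximal_integral_curve X A v I \<gamma>" and sub: "{0..t} \<subseteq> I"
    and \<gamma>: "\<forall>u\<in>{0..t}. \<gamma> u = \<delta> u"
    by (rule curve_extends[OF \<delta>(1)])
  have "0 \<in> I" "t \<in> I" "\<gamma> 0 = x" "\<gamma> t = y"
    using sub \<open>0 \<le> t\<close> \<gamma> \<delta> by auto
  then show "(x, y) \<in> trajectory_order X A v"
    unfolding trajectory_order_def using max \<open>0 \<le> t\<close> by blast
qed

end

section \<open>Smooth maps\<close>

lemma smooth_on_has_derivative:
  assumes "smooth_on S h" "p \<in> S"
  shows "(h has_derivative frechet_derivative h (at p within S)) (at p within S)"
proof -
  obtain U g where U: "open U" "p \<in> U" and Ck: "\<forall>k. Ck_on k U g" and eq: "\<forall>q\<in>S \<inter> U. g q = h q"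
    using assms unfolding smooth_on_def by blast
  have "Ck_on (Suc 0) U g" using Ck by blast
  then have "g differentiable (at p)" using U by simp
  then obtain D where "(g has_derivative D) (at p)" by (auto simp: differentiable_def)
  then have "(g has_derivative D) (at p within S \<inter> U)" by (rule has_derivative_at_withinI)
  then have "(h has_derivative D) (at p within S \<inter> U)"
    by (rule has_derivative_transform[rotated 2]) (use eq assms U in auto)
  moreover have "at p within S \<inter> U = at p within S"
    by (rule at_within_nhd[OF \<open>p \<in> U\<close> \<open>open U\<close>]) blast
  ultimately have "h differentiable (at p within S)"
    by (auto simp: differentiable_def)
  then show ?thesis by (simp add: frechet_derivative_works)
qed

text \<open>The mean value inequality is applied to a smooth extension on a full ball, which is
  convex even when \<open>S\<close> is not. The sum \<open>N\<close> of the norms of the partial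
  derivatives bounds the operator norm and is continuous, hence bounded on the closed ball.\<close>

lemma smooth_on_locally_lipschitz:
  assumes "smooth_on S h" "p \<in> S"
  obtains r K where "r > 0" "K-lipschitz_on (cball p r \<inter> S) h"
proof -
  obtain U g where U: "open U" "p \<in> U" and Ck: "\<forall>k. Ck_on k U g" and eq: "\<forall>q\<in>S \<inter> U. g q = h q"
    using assms unfolding smooth_on_def by blast
  have C1: "Ck_on (Suc 0) U g" using Ck by blast
  then have diff: "\<And>q. q \<in> U \<Longrightarrow> (g has_derivative frechet_derivative g (at q)) (at q)"
    and cont: "\<And>u. continuous_on U (\<lambda>q. frechet_derivative g (at q) u)"
    by (auto simp: frechet_derivative_works)
  obtain r where r: "r > 0" "cball p r \<subseteq> U"
    using U open_contains_cball by blast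
  define N where "N q = (\<Sum>b\<in>Basis. norm (frechet_derivative g (at q) b))" for q
  have "continuous_on (cball p r) N"
    unfolding N_def by (intro continuous_intros continuous_on_subset[OF cont r(2)])
  then have "compact (N ` cball p r)"
    by (rule compact_continuous_image) simp
  then obtain K where "K > 0" and "\<forall>y \<in> N ` cball p r. norm y \<le> K"
    using compact_imp_bounded bounded_pos by blast
  have K: "N q \<le> K" if "q \<in> cball p r" for q
  proof -
    have "norm (N q) \<le> K"
      using \<open>\<forall>y \<in> N ` cball p r. norm y \<le> K\<close> imageI[OF that] by (rule bspec)
    then show ?thesis by simp
  qed
  have "K-lipschitz_on (cball p r \<inter> S) h"
  proof (rule lipschitz_onI)
    fix x y assume xy: "x \<in> cball p r \<inter> S" "y \<in> cball p r \<inter> S"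
    have "norm (g x - g y) \<le> K * norm (x - y)"
    proof (rule differentiable_bound[where S = "cball p r"])
      fix q assume q: "q \<in> cball p r"
      then have D: "(g has_derivative frechet_derivative g (at q)) (at q)" using diff r(2) by blast
      then show "(g has_derivative frechet_derivative g (at q)) (at q within cball p r)"
        by (rule has_derivative_at_withinI)
      show "onorm (frechet_derivative g (at q)) \<le> K"
        using onorm_componentwise[OF has_derivative_bounded_linear[OF D]] K[OF q] by (simp add: N_def)
    qed (use xy in auto)
    moreover have "g x = h x" "g y = h y" using eq xy r(2) by auto
    ultimately show "dist (h x) (h y) \<le> K * dist x y" by (simp add: dist_norm)
  qed (use \<open>K > 0\<close> in simp)
  then show thesis using that r(1) by blast
qed

lemma compact_vfield_smooth:
  assumes "smooth_manifold_with_boundary X A" "compact_space X" "smooth_vector_field A v"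
  shows "compact_vfield X A v"
proof
  show ch: "chart_on X c" if "c \<in> A" for c
    using assms(1) that by (simp add: smooth_manifold_with_boundary_def)
  fix c d x assume c: "c \<in> A" "d \<in> A" "x \<in> cdom c \<inter> cdom d"
  have "smooth_on (coord c ` (cdom c \<inter> cdom d)) (coord d \<circ> cinv c)"
    using assms(1) c by (simp add: smooth_manifold_with_boundary_def)
  from smooth_on_has_derivative[OF this, of "coord c x"] c(3)
  have "((coord d \<circ> cinv c) has_derivative frechet_derivative (coord d \<circ> cinv c)
      (at (coord c x) within coord c ` (cdom c \<inter> cdom d)))
      (at (coord c x) within coord c ` (cdom c \<inter> cdom d))"
    by blast
  moreover have "v d x = frechet_derivative (coord d \<circ> cinv c)
      (at (coord c x) within coord c ` (cdom c \<inter> cdom d)) (v c x)"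
    using assms(3) c unfolding smooth_vector_field_def by blast
  ultimately show "\<exists>D. ((coord d \<circ> cinv c) has_derivative D) (at (coord c x) within coord c ` (cdom c \<inter> cdom d)) \<and>
      D (v c x) = v d x"
    by metis
next
  fix c x assume c: "c \<in> A" "x \<in> cdom c"
  have "openin (top_of_set half_space) (coord c ` cdom c)"
    using assms(1) c(1) by (simp add: smooth_manifold_with_boundary_def chart_on_def)
  then obtain V where "open V" and V: "coord c ` cdom c = half_space \<inter> V"
    by (auto simp: openin_open)
  moreover have "coord c x \<in> V" using V c(2) by blast
  ultimately obtain s where s: "s > 0" "cball (coord c x) s \<subseteq> V"
    using open_contains_cball by blast
  have "smooth_on (coord c ` cdom c) (v c \<circ> cinv c)"
    using assms(3) c(1) unfolding smooth_vector_field_def by blast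
  then obtain r K where r: "r > 0" and K: "K-lipschitz_on (cball (coord c x) r \<inter> coord c ` cdom c) (v c \<circ> cinv c)"
    using smooth_on_locally_lipschitz[of _ _ "coord c x"] c(2) by blast
  have "cball (coord c x) (min r s) \<inter> half_space \<subseteq> cball (coord c x) r \<inter> coord c ` cdom c"
    using s(2) V by auto
  then show "\<exists>r>0. \<exists>K. cball (coord c x) r \<inter> half_space \<subseteq> coord c ` cdom c \<and>
        K-lipschitz_on (cball (coord c x) r \<inter> half_space) (v c \<circ> cinv c)"
    using r s(1) lipschitz_on_subset[OF K] by (intro exI[of _ "min r s"] conjI exI[of _ K]) auto
qed (use assms in \<open>auto simp: smooth_manifold_with_boundary_def\<close>)

text \<open>By invariance of domain, a change of charts cannot move an interior point of the half-space
  to its frontier.\<close>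

lemma closedin_mboundary:
  fixes A :: "('a, 'e::euclidean_space) chart set"
  assumes "smooth_manifold_with_boundary X A"
  shows "closedin X (mboundary A)"
proof -
  have ch: "chart_on X c" if "c \<in> A" for c
    using assms that by (simp add: smooth_manifold_with_boundary_def)
  have cover: "(\<Union>c\<in>A. cdom c) = topspace X"
    using assms by (simp add: smooth_manifold_with_boundary_def)
  have frontier: "frontier half_space = half_space - interior (half_space :: 'e set)"
    by (simp add: frontier_def closure_closed closed_half_space)
  have int: "coord d x \<in> interior half_space"
    if c: "c \<in> A" "d \<in> A" "x \<in> cdom c" "x \<in> cdom d" "coord c x \<in> interior half_space" for c d x
  proof -
    let ?Z = "coord c ` (cdom c \<inter> cdom d)"
    have "openin (subtopology X (cdom c)) (cdom c \<inter> cdom d)"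
      using chart_on_props(1)[OF ch[OF c(2)]] by (auto simp: openin_subtopology)
    moreover have "homeomorphic_map (subtopology X (cdom c)) (top_of_set (coord c ` cdom c)) (coord c)"
      and o: "openin (top_of_set half_space) (coord c ` cdom c)"
      using ch[OF c(1)] by (auto simp: chart_on_def)
    ultimately have "openin (top_of_set (coord c ` cdom c)) ?Z"
      using homeomorphic_imp_open_map unfolding open_map_def by blast
    then have "openin (top_of_set half_space) ?Z"
      using o openin_trans by blast
    then obtain V where "open V" "?Z = half_space \<inter> V"
      by (auto simp: openin_open)
    \<comment> \<open>\<open>?Z\<close> is open only relative to the half-space; its part in the
      interior is open in the whole Euclidean space, as invariance of domain demands.\<close>
    then have "?Z \<inter> interior half_space = V \<inter> interior half_space"
      using interior_subset by blast
    then have op: "open (?Z \<inter> interior half_space)"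
      using \<open>open V\<close> by auto
    have "continuous_on ?Z (coord d \<circ> cinv c)"
    proof -
      have "smooth_on ?Z (coord d \<circ> cinv c)"
        using assms c by (simp add: smooth_manifold_with_boundary_def)
      from has_derivative_continuous[OF smooth_on_has_derivative[OF this]] show ?thesis
        unfolding continuous_on_eq_continuous_within by blast
    qed
    then have cont: "continuous_on (?Z \<inter> interior half_space) (coord d \<circ> cinv c)"
      by (rule continuous_on_subset) blast
    have inj: "inj_on (coord d \<circ> cinv c) (?Z \<inter> interior half_space)"
    proof (rule inj_onI)
      fix p q assume *: "p \<in> ?Z \<inter> interior half_space" "q \<in> ?Z \<inter> interior half_space"
        "(coord d \<circ> cinv c) p = (coord d \<circ> cinv c) q"
      then obtain y z where "p = coord c y" "y \<in> cdom c \<inter> cdom d" "q = coord c z" "z \<in> cdom c \<inter> cdom d"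
        by blast
      then show "p = q"
        using *(3) cinv_coord[OF ch[OF c(1)]] chart_on_props(3)[OF ch[OF c(2)]] by (auto simp: inj_on_def)
    qed
    have "open ((coord d \<circ> cinv c) ` (?Z \<inter> interior half_space))"
      by (rule invariance_of_domain[OF cont op inj])
    moreover have "(coord d \<circ> cinv c) ` (?Z \<inter> interior half_space) \<subseteq> half_space"
      using cinv_coord[OF ch[OF c(1)]] chart_on_props(4)[OF ch[OF c(2)]] by auto
    ultimately have "(coord d \<circ> cinv c) ` (?Z \<inter> interior half_space) \<subseteq> interior half_space"
      by (rule interior_maximal[rotated])
    moreover have "coord d x = (coord d \<circ> cinv c) (coord c x)"
      using cinv_coord[OF ch[OF c(1)]] c by simp
    ultimately show ?thesis
      using c(3-5) by blast
  qed
  \<comment> \<open>A boundary point is one that some chart sends to the frontier. By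
    \<open>int\<close>, being interior in one chart excludes this in every chart, so the complement
    is a union of open sets.\<close>
  have "topspace X - mboundary A = (\<Union>c\<in>A. {x \<in> cdom c. coord c x \<in> interior half_space})"
  proof (intro set_eqI iffI)
    fix x assume x: "x \<in> topspace X - mboundary A"
    then obtain c where c: "c \<in> A" "x \<in> cdom c" using cover by blast
    moreover have "coord c x \<in> half_space"
      using chart_on_props(4)[OF ch[OF c(1)]] c(2) by blast
    ultimately show "x \<in> (\<Union>c\<in>A. {x \<in> cdom c. coord c x \<in> interior half_space})"
      using x unfolding mboundary_def frontier by blast
  next
    fix x assume "x \<in> (\<Union>c\<in>A. {x \<in> cdom c. coord c x \<in> interior half_space})"
    then obtain c where c: "c \<in> A" "x \<in> cdom c" "coord c x \<in> interior half_space" by blast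
    then have "x \<notin> mboundary A"
      using int[OF c(1) _ c(2) _ c(3)] unfolding mboundary_def frontier by blast
    then show "x \<in> topspace X - mboundary A" using c cover by blast
  qed
  moreover have "openin X (\<Union>c\<in>A. {x \<in> cdom c. coord c x \<in> interior half_space})"
    using openin_coord_preimage[OF ch] by (intro openin_Union) auto
  moreover have "mboundary A \<subseteq> topspace X"
    using cover by (auto simp: mboundary_def)
  ultimately show ?thesis
    by (simp add: closedin_def)
qed

section \<open>Lyapunov functions\<close>

locale lyapunov_vfield = compact_vfield X A v
  for X :: "'a topology" and A :: "('a, 'e::euclidean_space) chart set" and v :: "('a, 'e) vfield" +
  fixes f :: "'a \<Rightarrow> real"
  assumes increasing: "\<And>c x. \<lbrakk>c \<in> A; x \<in> cdom c\<rbrakk> \<Longrightarrow>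
    \<exists>D. ((f \<circ> cinv c) has_derivative D) (at (coord c x) within coord c ` cdom c) \<and> 0 < D (v c x)"
begin

lemma continuous_map_lyapunov: "continuous_map X euclideanreal f"
proof (rule pasting_lemma[where I = A and T = cdom and f = "\<lambda>_. f"])
  fix c assume c: "c \<in> A"
  note ch = chart[OF c]
  show "openin X (cdom c)" by (rule chart_on_props(1)[OF ch])
  have "continuous_on (coord c ` cdom c) (f \<circ> cinv c)"
    unfolding continuous_on_eq_continuous_within
    using increasing[OF c] has_derivative_continuous by blast
  then have "continuous_map (top_of_set (coord c ` cdom c)) euclideanreal (f \<circ> cinv c)" by simp
  moreover have "continuous_map (subtopology X (cdom c)) (top_of_set (coord c ` cdom c)) (coord c)"
    using chart_on_props(5)[OF ch] by (auto simp: continuous_map_in_subtopology)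
  ultimately have "continuous_map (subtopology X (cdom c)) euclideanreal (f \<circ> cinv c \<circ> coord c)"
    by (rule continuous_map_compose[rotated])
  then show "continuous_map (subtopology X (cdom c)) euclideanreal f"
    by (rule continuous_map_eq) (use cinv_coord[OF ch] in auto)
next
  fix x assume "x \<in> topspace X"
  then show "\<exists>c. c \<in> A \<and> x \<in> cdom c \<and> f x = f x"
    using cover by blast
qed simp

lemma flow_less:
  assumes "flow X A v t x y" "0 < t"
  shows "f x < f y"
proof -
  obtain \<gamma> where \<gamma>: "curve {0..t} \<gamma>" "\<gamma> 0 = x" "\<gamma> t = y"
    using assms(1) by (rule flowE)
  have cont: "continuous_map (top_of_set {0..t}) X \<gamma>"
    using \<gamma>(1) by (simp add: integral_curve_def)
  have "(f \<circ> \<gamma>) 0 < (f \<circ> \<gamma>) t"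
  proof (rule DERIV_pos_imp_increasing_open[OF \<open>0 < t\<close>])
    fix s assume s: "0 < s" "s < t"
    then have st: "s \<in> {0..t}" by simp
    then have "\<gamma> s \<in> topspace X" by (rule curve_topspace[OF \<gamma>(1)])
    then obtain c where c: "c \<in> A" "\<gamma> s \<in> cdom c"
      using cover by blast
    then obtain D where D: "((f \<circ> cinv c) has_derivative D) (at (coord c (\<gamma> s)) within coord c ` cdom c)"
      "0 < D (v c (\<gamma> s))"
      using increasing by blast
    have "((f \<circ> \<gamma>) has_vector_derivative D (v c (\<gamma> s))) (at s within {0..t})"
      by (rule has_vector_derivative_through_chart[OF chart[OF c(1)] chart_on_props(1)[OF chart[OF c(1)]]
            order_refl cont st c(2) curve_coord_derivative[OF \<gamma>(1) st c] D(1)])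
    moreover have "at s within {0..t} = at s"
      using s by (intro at_within_interior) auto
    ultimately show "\<exists>d. ((f \<circ> \<gamma>) has_real_derivative d) (at s) \<and> d > 0"
      using D(2) by (auto simp: has_real_derivative_iff_has_vector_derivative)
  next
    show "continuous_on {0..t} (f \<circ> \<gamma>)"
      using continuous_map_compose[OF cont continuous_map_lyapunov] by simp
  qed
  then show ?thesis using \<gamma> by simp
qed

lemma flow_zero: "flow X A v 0 x y \<Longrightarrow> x = y"
  by (auto simp: flow_def)

lemma reach_le:
  assumes "reach x y"
  shows "f x \<le> f y"
proof -
  obtain t where t: "flow X A v t x y" using assms by (auto simp: reachable_def)
  then have "0 \<le> t" by (rule flow_topspace(3))
  then show ?thesis
    using flow_less[OF t] flow_zero[of x y] t by (cases "t = 0") auto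
qed

lemma reach_eq:
  assumes "reach x y" "f y \<le> f x"
  shows "x = y"
proof -
  obtain t where t: "flow X A v t x y" using assms by (auto simp: reachable_def)
  then have "0 \<le> t" by (rule flow_topspace(3))
  then show ?thesis
    using flow_less[OF t] flow_zero[of x y] t assms(2) by (cases "t = 0") auto
qed

text \<open>The height decides the direction along a leaf: reaching in the other direction is
  possible only if the points coincide.\<close>

lemma link_reach:
  assumes "link x y" "f x \<le> f y"
  shows "reach x y"
proof (cases "reach x y")
  case False
  then have "reach y x" using assms(1) by (simp add: linked_def)
  then have "y = x" using assms(2) by (rule reach_eq)
  then show ?thesis using \<open>reach y x\<close> by simp
qed

text \<open>Flowing for the fixed time \<open>\<tau>\<close> raises \<open>f\<close> by at least some \<open>\<delta> > 0\<close>, by compactness. As \<open>f\<close> is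
  bounded, this bounds the life time of all integral curves, so reachability is a finite composition
  of short-time flows.\<close>

lemma flow_time_bounded:
  obtains \<tau> n where "0 < \<tau>"
    "\<And>T. \<lbrakk>compact T; T \<subseteq> {0..\<tau>}\<rbrakk> \<Longrightarrow> closedin (prod_topology X X) {(y, z). \<exists>t\<in>T. flow X A v t y z}"
    "\<And>t x y. flow X A v t x y \<Longrightarrow> t \<le> real n * \<tau>"
proof -
  obtain \<tau> where "0 < \<tau>" and cl: "\<And>T. \<lbrakk>compact T; T \<subseteq> {0..\<tau>}\<rbrakk> \<Longrightarrow>
      closedin (prod_topology X X) {(y, z). \<exists>t\<in>T. flow X A v t y z}"
    by (rule flow_uniform) blast
  define S where "S = {(y, z). flow X A v \<tau> y z}"
  have "closedin (prod_topology X X) S"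
    using cl[of "{\<tau>}"] \<open>0 < \<tau>\<close> by (simp add: S_def)
  moreover have "compact_space (prod_topology X X)"
    using compact by (simp add: compact_space_prod_topology)
  ultimately have "compactin (prod_topology X X) S"
    by (rule closedin_compact_space[rotated])
  moreover have "continuous_map (prod_topology X X) euclideanreal (\<lambda>p. f (snd p) - f (fst p))"
    by (intro continuous_map_diff continuous_map_compose[OF continuous_map_snd continuous_map_lyapunov, unfolded o_def]
        continuous_map_compose[OF continuous_map_fst continuous_map_lyapunov, unfolded o_def])
  ultimately have "compactin euclideanreal ((\<lambda>p. f (snd p) - f (fst p)) ` S)"
    by (rule image_compactin)
  then have cS: "Topological_Spaces.compact ((\<lambda>p. f (snd p) - f (fst p)) ` S)" by simp
  \<comment> \<open>The increment of \<open>f\<close> is positive on the compact set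
    \<open>S\<close> and attains its minimum. If no curve lives for time \<open>\<tau>\<close>, any
    \<open>\<delta>\<close> will do.\<close>
  have "\<exists>\<delta>>0. \<forall>p\<in>S. \<delta> \<le> f (snd p) - f (fst p)"
  proof (cases "S = {}")
    case True
    then show ?thesis by (intro exI[of _ 1]) simp
  next
    case False
    then obtain p where "p \<in> S" "\<forall>q\<in>S. f (snd p) - f (fst p) \<le> f (snd q) - f (fst q)"
      using compact_attains_inf[OF cS] by auto
    moreover have "0 < f (snd p) - f (fst p)"
      using \<open>p \<in> S\<close> flow_less \<open>0 < \<tau>\<close> by (auto simp: S_def)
    ultimately show ?thesis by blast
  qed
  then obtain \<delta> where "\<delta> > 0" and \<delta>: "\<And>x y. flow X A v \<tau> x y \<Longrightarrow> f x + \<delta> \<le> f y"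
    by (force simp: S_def)
  have gain: "f x + real n * \<delta> \<le> f y" if "flow X A v (real n * \<tau>) x y" for n x y
    using that
  proof (induction n arbitrary: x)
    case 0
    then show ?case using flow_zero[of x y] by simp
  next
    case (Suc n)
    have "flow X A v (\<tau> + real n * \<tau>) x y"
      using Suc.prems by (simp add: algebra_simps)
    then obtain z where "flow X A v \<tau> x z" "flow X A v (real n * \<tau>) z y"
      by (rule flow_split) (use \<open>0 < \<tau>\<close> in auto)
    then show ?case
      using \<delta> Suc.IH by (fastforce simp: algebra_simps)
  qed
  have "compactin euclideanreal (f ` topspace X)"
    using compact continuous_map_lyapunov unfolding compact_space_def by (rule image_compactin)
  then have "bounded (f ` topspace X)"
    by (simp add: compact_imp_bounded)
  then obtain B where B: "\<And>x. x \<in> topspace X \<Longrightarrow> \<bar>f x\<bar> \<le> B"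
    by (auto simp: bounded_iff)
  \<comment> \<open>The values of \<open>f\<close> differ by at most \<open>2 * B\<close>, so
    \<open>n\<close> successive gains of \<open>\<delta>\<close> are impossible.\<close>
  obtain n :: nat where n: "2 * B < real n * \<delta>"
    using reals_Archimedean3[OF \<open>\<delta> > 0\<close>] by auto
  have "t \<le> real n * \<tau>" if t: "flow X A v t x y" for t x y
  proof (rule ccontr)
    assume "\<not> t \<le> real n * \<tau>"
    then have "flow X A v (real n * \<tau> + (t - real n * \<tau>)) x y" "0 \<le> real n * \<tau>" "0 \<le> t - real n * \<tau>"
      using t \<open>0 < \<tau>\<close> by auto
    then obtain z where z: "flow X A v (real n * \<tau>) x z"
      by (rule flow_split)
    then have "f x + real n * \<delta> \<le> f z" by (rule gain)
    then show False
      using n B[OF flow_topspace(1)[OF z]] B[OF flow_topspace(2)[OF z]] by linarith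
  qed
  then show thesis using that[OF \<open>0 < \<tau>\<close> cl] by blast
qed

lemma closedin_reach: "closedin (prod_topology X X) {(x, y). reach x y}"
proof -
  obtain \<tau> n where "0 < \<tau>"
    and cl: "\<And>T. \<lbrakk>compact T; T \<subseteq> {0..\<tau>}\<rbrakk> \<Longrightarrow> closedin (prod_topology X X) {(y, z). \<exists>t\<in>T. flow X A v t y z}"
    and bound: "\<And>t x y. flow X A v t x y \<Longrightarrow> t \<le> real n * \<tau>"
    by (rule flow_time_bounded) blast
  define R where "R m = {(x, y). \<exists>t\<in>{0..real m * \<tau>}. flow X A v t x y}" for m :: nat
  have R1: "closedin (prod_topology X X) (R 1)"
    using cl[of "{0..\<tau>}"] by (simp add: R_def)
  have comp: "R (Suc m) = R m O R 1" for m
  proof (intro set_eqI iffI)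
    fix p assume "p \<in> R (Suc m)"
    then obtain x y t where p: "p = (x, y)" and t: "0 \<le> t" "t \<le> real (Suc m) * \<tau>" "flow X A v t x y"
      by (auto simp: R_def)
    \<comment> \<open>The first \<open>m\<close> steps take as much of the time as they can; what is
      left is at most one \<open>\<tau>\<close>.\<close>
    define s where "s = min t (real m * \<tau>)"
    have s: "0 \<le> s" "s \<le> real m * \<tau>" "0 \<le> t - s" "t - s \<le> \<tau>"
      using t \<open>0 < \<tau>\<close> by (auto simp: s_def algebra_simps min_def)
    have "flow X A v (s + (t - s)) x y" using t by simp
    then obtain z where "flow X A v s x z" "flow X A v (t - s) z y"
      using s(1,3) by (rule flow_split)
    then have "(x, z) \<in> R m" "(z, y) \<in> R 1"
      using s by (auto simp: R_def)
    then show "p \<in> R m O R 1"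
      unfolding p by (rule relcompI)
  next
    fix p assume "p \<in> R m O R 1"
    then obtain x y z s t where p: "p = (x, y)" and "0 \<le> s" "s \<le> real m * \<tau>" "flow X A v s x z"
      "0 \<le> t" "t \<le> \<tau>" "flow X A v t z y"
      by (auto simp: R_def)
    then have "s + t \<in> {0..real (Suc m) * \<tau>}" "flow X A v (s + t) x y"
      using flow_trans by (auto simp: algebra_simps)
    then show "p \<in> R (Suc m)"
      using p by (auto simp: R_def simp del: of_nat_Suc)
  qed
  have "closedin (prod_topology X X) (R (Suc m))" for m
  proof (induction m)
    case 0
    then show ?case using R1 by simp
  next
    case (Suc m)
    then show ?case
      using comp[of "Suc m"] closedin_relcomp[OF compact Suc R1] by simp
  qed
  \<comment> \<open>The induction starts at \<open>R 1\<close>, so \<open>Suc n\<close> is used in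
    place of \<open>n\<close>, which may be 0.\<close>
  moreover have "{(x, y). reach x y} = R (Suc n)"
  proof -
    have "t \<in> {0..real (Suc n) * \<tau>}" if "flow X A v t x y" for t x y
      using bound[OF that] flow_topspace(3)[OF that] \<open>0 < \<tau>\<close> by (simp add: algebra_simps)
    then show ?thesis by (auto simp: R_def reachable_def simp del: of_nat_Suc)
  qed
  ultimately show ?thesis by simp
qed

lemma closedin_link: "closedin (prod_topology X X) {(x, y). link x y}"
proof -
  let ?P = "prod_topology X X"
  have "continuous_map ?P ?P (\<lambda>p. (snd p, fst p))"
    by (intro continuous_map_pairedI continuous_map_fst continuous_map_snd)
  from closedin_continuous_map_preimage[OF this closedin_reach]
  have "closedin ?P ({(x, y). reach x y} \<union> {p \<in> topspace ?P. (snd p, fst p) \<in> {(x, y). reach x y}})"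
    using closedin_reach by (rule closedin_Un[rotated])
  moreover have "{(x, y). reach x y} \<union> {p \<in> topspace ?P. (snd p, fst p) \<in> {(x, y). reach x y}} = {(x, y). link x y}"
    using reach_topspace by (auto simp: linked_def)
  ultimately show ?thesis by simp
qed

end

section \<open>Traversing fields: boundary points below and above every point\<close>

text \<open>This is the form in which the shape of the leaves enters the reconstruction: on the leaf
  of \<open>x\<close> the boundary values of \<open>f\<close> enclose \<open>f x\<close>.\<close>

locale traversed = lyapunov_vfield X A v f
  for X :: "'a topology" and A :: "('a, 'e::euclidean_space) chart set" and v :: "('a, 'e) vfield"
    and f :: "'a \<Rightarrow> real" +
  assumes closedin_boundary: "closedin X (mboundary A)"
    and ends: "\<And>x. x \<in> topspace X \<Longrightarrow> \<exists>a\<in>mboundary A. \<exists>b\<in>mboundary A. reachable X A v a x \<and> reachable X A v x b"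

lemma traversed_traversing:
  assumes X: "smooth_manifold_with_boundary X A" "compact_space X" and v: "traversing X A v" and f: "lyapunov A v f"
  shows "traversed X A v f"
proof -
  interpret compact_vfield X A v
    using compact_vfield_smooth[OF X] v by (simp add: traversing_def)
  interpret lyapunov_vfield X A v f
  proof
    fix c x assume c: "c \<in> A" "x \<in> cdom c"
    have "smooth_on (coord c ` cdom c) (f \<circ> cinv c)"
      using f c unfolding lyapunov_def smooth_fun_def by blast
    from smooth_on_has_derivative[OF this imageI[OF c(2)]] f c
    show "\<exists>D. ((f \<circ> cinv c) has_derivative D) (at (coord c x) within coord c ` cdom c) \<and> 0 < D (v c x)"
      unfolding lyapunov_def by blast
  qed
  show ?thesis
  proof
    show "closedin X (mboundary A)" by (rule closedin_mboundary[OF X(1)])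
    fix x assume x: "x \<in> topspace X"
    define L where "L = {y. link x y}"
    have L: "L \<in> trajectories X A v"
      unfolding trajectories_eq L_def by (intro CollectI exI[of _ x] conjI refl x)
    have xL: "x \<in> L" using link_refl[OF x] by (simp add: L_def)
    have reach: "reach y z" if "y \<in> L" "z \<in> L" "f y \<le> f z" for y z
    proof -
      have "link y z"
        using that link_trans[OF link_sym, of x y z] by (simp add: L_def)
      then show ?thesis using that(3) by (rule link_reach)
    qed
    have "(\<exists>g. homeomorphic_map (top_of_set {0..1::real}) (subtopology X L) g \<and>
             g 0 \<in> mboundary A \<and> g 1 \<in> mboundary A) \<or> (\<exists>x\<in>mboundary A. L = {x})"
      using v L unfolding traversing_def by blast
    then show "\<exists>a\<in>mboundary A. \<exists>b\<in>mboundary A. reach a x \<and> reach x b"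
    proof
      assume "\<exists>x\<in>mboundary A. L = {x}"
      then have "x \<in> mboundary A" using xL by auto
      then show ?thesis using reach[OF xL xL] by auto
    next
      assume "\<exists>g. homeomorphic_map (top_of_set {0..1::real}) (subtopology X L) g \<and>
             g 0 \<in> mboundary A \<and> g 1 \<in> mboundary A"
      then obtain g where g: "homeomorphic_map (top_of_set {0..1::real}) (subtopology X L) g"
        and g01: "g 0 \<in> mboundary A" "g 1 \<in> mboundary A" by blast
      have "L \<subseteq> topspace X" using link_topspace by (auto simp: L_def)
      then have gL: "g ` {0..1} = L"
        using homeomorphic_imp_surjective_map[OF g] by auto
      have "continuous_map (top_of_set {0..1}) X g"
        using homeomorphic_imp_continuous_map[OF g] continuous_map_into_fulltopology by blast
      from continuous_map_compose[OF this continuous_map_lyapunov]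
      have cont: "continuous_on {0..1} (f \<circ> g)" by simp
      \<comment> \<open>The parametrization of \<open>L\<close> by the unit interval is unrelated to
        time. But \<open>f\<close> is injective on a leaf, so \<open>f \<circ> g\<close> is
        continuous and injective, hence monotone, and the ends of \<open>L\<close> carry the extreme
        heights.\<close>
      have inj: "inj_on (f \<circ> g) {0..1}"
      proof (rule inj_onI)
        fix s t :: real assume st: "s \<in> {0..1}" "t \<in> {0..1}" "(f \<circ> g) s = (f \<circ> g) t"
        then have "g s = g t"
          using reach[of "g s" "g t"] reach_eq[of "g s" "g t"] gL by auto
        then show "s = t"
          using st homeomorphic_imp_injective_map[OF g] by (simp add: inj_on_def)
      qed
      obtain u where u: "u \<in> {0..1}" "x = g u" using xL gL by blast
      have mem: "g 0 \<in> L" "g 1 \<in> L" using gL by auto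
      have "f (g 0) \<le> f x \<and> f x \<le> f (g 1) \<or> f (g 1) \<le> f x \<and> f x \<le> f (g 0)"
      proof (cases "u = 0 \<or> u = 1")
        case True
        then show ?thesis using u(2) by auto
      next
        case False
        then show ?thesis
          using continuous_inj_imp_mono[OF _ _ cont inj, of u] u by auto
      qed
      then show ?thesis
        using reach mem xL g01 by blast
    qed
  qed
qed

section \<open>Reconstruction from boundary data\<close>

lemma (in traversed) boundary_order_iff:
  assumes "a \<in> mboundary A" "b \<in> mboundary A"
  shows "(a, b) \<in> boundary_order X A v \<longleftrightarrow> reachable X A v a b"
  using assms by (simp add: boundary_order_def trajectory_order_iff)

text \<open>Makes the hypotheses symmetric in the two manifolds, so that the construction can be run
  in both directions.\<close>

lemma boundary_data_iso_inverse:
  assumes "boundary_data_iso X A v f Y B w g \<phi>"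
    and sub: "mboundary A \<subseteq> topspace X" "mboundary B \<subseteq> topspace Y"
  obtains \<psi> where "boundary_data_iso Y B w g X A v f \<psi>" "\<And>x. x \<in> mboundary A \<Longrightarrow> \<psi> (\<phi> x) = x"
    "\<And>y. y \<in> mboundary B \<Longrightarrow> \<phi> (\<psi> y) = y" "\<phi> ` mboundary A = mboundary B" "\<psi> ` mboundary B = mboundary A"
proof -
  have ts: "topspace (subtopology X (mboundary A)) = mboundary A"
    "topspace (subtopology Y (mboundary B)) = mboundary B"
    using sub by auto
  have \<phi>: "homeomorphic_map (subtopology X (mboundary A)) (subtopology Y (mboundary B)) \<phi>"
    using assms(1) by (simp add: boundary_data_iso_def)
  then obtain \<psi> where "homeomorphic_maps (subtopology X (mboundary A)) (subtopology Y (mboundary B)) \<phi> \<psi>"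
    using homeomorphic_map_maps by blast
  then have \<psi>: "homeomorphic_map (subtopology Y (mboundary B)) (subtopology X (mboundary A)) \<psi>"
    and inv: "\<And>x. x \<in> mboundary A \<Longrightarrow> \<psi> (\<phi> x) = x" "\<And>y. y \<in> mboundary B \<Longrightarrow> \<phi> (\<psi> y) = y"
    unfolding homeomorphic_maps_map ts by auto
  have im: "\<phi> ` mboundary A = mboundary B" "\<psi> ` mboundary B = mboundary A"
    using homeomorphic_imp_surjective_map[OF \<phi>] homeomorphic_imp_surjective_map[OF \<psi>] ts by auto
  have "boundary_data_iso Y B w g X A v f \<psi>"
    unfolding boundary_data_iso_def
  proof (intro conjI ballI \<psi>)
    have order: "(x, y) \<in> boundary_order X A v \<longleftrightarrow> (\<phi> x, \<phi> y) \<in> boundary_order Y B w"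
      if "x \<in> mboundary A" "y \<in> mboundary A" for x y
      using assms(1) that by (simp add: boundary_data_iso_def)
    have val: "g (\<phi> x) = f x" if "x \<in> mboundary A" for x
      using assms(1) that by (simp add: boundary_data_iso_def)
    fix x assume x: "x \<in> mboundary B"
    then have \<psi>x: "\<psi> x \<in> mboundary A" using im(2) by blast
    show "f (\<psi> x) = g x" using val[OF \<psi>x] inv(2)[OF x] by simp
    fix y assume y: "y \<in> mboundary B"
    then have "\<psi> y \<in> mboundary A" using im(2) by blast
    from order[OF \<psi>x this]
    show "(x, y) \<in> boundary_order Y B w \<longleftrightarrow> (\<psi> x, \<psi> y) \<in> boundary_order X A v"
      using inv(2) x y by simp
  qed
  then show thesis using that inv im by blast
qed

section \<open>Matching points by leaf and height\<close>

locale boundary_iso = X: traversed X A v f + Y: traversed Y B w g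
  for X :: "'a topology" and A :: "('a, 'e::euclidean_space) chart set" and v :: "('a, 'e) vfield"
    and f :: "'a \<Rightarrow> real"
    and Y :: "'b topology" and B :: "('b, 'd::euclidean_space) chart set" and w :: "('b, 'd) vfield"
    and g :: "'b \<Rightarrow> real" +
  fixes \<phi> :: "'a \<Rightarrow> 'b"
  assumes iso: "boundary_data_iso X A v f Y B w g \<phi>"
begin

definition corresponds :: "'a \<Rightarrow> 'b \<Rightarrow> bool" where
  "corresponds x y \<longleftrightarrow> g y = f x \<and> (\<exists>a\<in>mboundary A. X.link a x \<and> Y.link (\<phi> a) y)"

lemma boundary_subset: "mboundary A \<subseteq> topspace X" "mboundary B \<subseteq> topspace Y"
  using X.closedin_boundary Y.closedin_boundary closedin_subset by blast+

lemma \<phi>_boundary: "a \<in> mboundary A \<Longrightarrow> \<phi> a \<in> mboundary B"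
  by (rule boundary_data_iso_inverse[OF iso boundary_subset]) blast

lemma \<phi>_reach:
  assumes "a \<in> mboundary A" "b \<in> mboundary A" "X.reach a b"
  shows "Y.reach (\<phi> a) (\<phi> b)"
  using assms iso \<phi>_boundary X.boundary_order_iff Y.boundary_order_iff
  by (simp add: boundary_data_iso_def)

lemma \<phi>_value: "a \<in> mboundary A \<Longrightarrow> g (\<phi> a) = f a"
  using iso by (simp add: boundary_data_iso_def)

lemma corresponds_topspace:
  assumes "corresponds x y"
  shows "x \<in> topspace X" "y \<in> topspace Y"
  using assms X.link_topspace Y.link_topspace by (auto simp: corresponds_def)

text \<open>Boundary points below and above \<open>x\<close> are sent to boundary points on one leaf
  of \<open>Y\<close>, at the same heights. The curve joining them passes the height
  \<open>f x\<close> by the intermediate value theorem.\<close>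

lemma corresponds_exists:
  assumes "x \<in> topspace X"
  obtains y where "corresponds x y"
proof -
  obtain a b where ab: "a \<in> mboundary A" "b \<in> mboundary A" "X.reach a x" "X.reach x b"
    using X.ends[OF assms] by blast
  then have "Y.reach (\<phi> a) (\<phi> b)"
    using \<phi>_reach X.reach_trans by blast
  then obtain t where "flow Y B w t (\<phi> a) (\<phi> b)" by (auto simp: reachable_def)
  then obtain \<gamma> where \<gamma>: "Y.curve {0..t} \<gamma>" "\<gamma> 0 = \<phi> a" "\<gamma> t = \<phi> b" "0 \<le> t"
    by (rule Y.flowE)
  have "continuous_map (top_of_set {0..t}) Y \<gamma>"
    using \<gamma>(1) by (simp add: integral_curve_def)
  from continuous_map_compose[OF this Y.continuous_map_lyapunov]
  have cont: "continuous_on {0..t} (g \<circ> \<gamma>)" by simp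
  have "(g \<circ> \<gamma>) 0 \<le> f x" "f x \<le> (g \<circ> \<gamma>) t"
    using \<gamma> ab \<phi>_value X.reach_le by auto
  then obtain s where s: "0 \<le> s" "s \<le> t" "(g \<circ> \<gamma>) s = f x"
    using IVT'[OF _ _ \<gamma>(4) cont] by blast
  have "flow Y B w (s - 0) (\<gamma> 0) (\<gamma> s)"
    by (rule Y.curve_flow[OF \<gamma>(1)]) (use s in auto)
  then have "Y.link (\<phi> a) (\<gamma> s)"
    using \<gamma>(2) by (auto simp: linked_def reachable_def)
  moreover have "X.link a x" using ab by (simp add: linked_def)
  ultimately have "corresponds x (\<gamma> s)"
    using s ab by (auto simp: corresponds_def)
  then show thesis by (rule that)
qed

text \<open>The anchors \<open>a\<close> and \<open>a'\<close> share a leaf, hence are comparable in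
  the boundary order; \<open>\<phi>\<close> preserves this, so \<open>y\<close> and
  \<open>y'\<close> share a leaf. Their heights give the direction.\<close>

lemma corresponds_reach:
  assumes "corresponds x y" "corresponds x' y'" "X.reach x x'"
  shows "Y.reach y y'"
proof (rule Y.link_reach)
  obtain a where a: "a \<in> mboundary A" "X.link a x" "Y.link (\<phi> a) y"
    using assms(1) by (auto simp: corresponds_def)
  obtain a' where a': "a' \<in> mboundary A" "X.link a' x'" "Y.link (\<phi> a') y'"
    using assms(2) by (auto simp: corresponds_def)
  have "X.link x x'" using assms(3) by (simp add: linked_def)
  then have "X.link a a'"
    using X.link_trans[OF X.link_trans[OF a(2)] X.link_sym[OF a'(2)]] by simp
  then have "Y.link (\<phi> a) (\<phi> a')"
    using \<phi>_reach a(1) a'(1) unfolding linked_def by blast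
  then show "Y.link y y'"
    using Y.link_trans[OF Y.link_trans[OF Y.link_sym[OF a(3)]] a'(3)] by simp
  show "g y \<le> g y'"
    using assms(1,2) X.reach_le[OF assms(3)] by (simp add: corresponds_def)
qed

text \<open>Monotonicity with \<open>x = x'\<close>: both points lie on one leaf at the same height.
  In particular the choice of the anchor \<open>a\<close> does not matter.\<close>

lemma corresponds_unique:
  assumes "corresponds x y" "corresponds x y'"
  shows "y = y'"
proof -
  have "X.reach x x"
    using X.flow_refl corresponds_topspace(1)[OF assms(1)] by (auto simp: reachable_def)
  then have "Y.reach y y'"
    by (rule corresponds_reach[OF assms])
  moreover have "g y' \<le> g y" using assms by (simp add: corresponds_def)
  ultimately show ?thesis by (rule Y.reach_eq)
qed

text \<open>The graph of \<open>\<phi>\<close> is compact because the boundary of \<open>X\<close>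
  is. Composing it with the closed leaf relations on both sides stays closed, and equality of
  heights is a closed condition.\<close>

lemma closedin_corresponds: "closedin (prod_topology X Y) {(x, y). corresponds x y}"
proof -
  let ?P = "prod_topology X Y"
  let ?graph = "(\<lambda>a. (a, \<phi> a)) ` mboundary A"
  have "compactin X (mboundary A)"
    using closedin_compact_space[OF X.compact X.closedin_boundary] .
  then have "compactin (subtopology X (mboundary A)) (mboundary A)"
    by (simp add: compactin_subtopology)
  moreover have "continuous_map (subtopology X (mboundary A)) (subtopology Y (mboundary B)) \<phi>"
    using iso homeomorphic_imp_continuous_map unfolding boundary_data_iso_def by blast
  then have "continuous_map (subtopology X (mboundary A)) ?P (\<lambda>a. (a, \<phi> a))"
    by (intro continuous_map_pairedI continuous_map_from_subtopology[OF continuous_map_id[unfolded id_def]])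
      (simp add: continuous_map_in_subtopology)
  ultimately have "compactin ?P ?graph"
    by (rule image_compactin)
  then have "closedin ?P ?graph"
    by (rule compactin_imp_closedin[rotated])
      (simp add: Hausdorff_space_prod_topology X.hausdorff Y.hausdorff)
  then have "closedin ?P (({(x, a). X.link x a} O ?graph) O {(b, y). Y.link b y})" (is "closedin _ ?R")
    by (intro closedin_relcomp[OF Y.compact] closedin_relcomp[OF X.compact] X.closedin_link Y.closedin_link)
  moreover have "continuous_map ?P euclideanreal (\<lambda>p. g (snd p) - f (fst p))"
    by (intro continuous_map_diff
        continuous_map_compose[OF continuous_map_snd Y.continuous_map_lyapunov, unfolded o_def]
        continuous_map_compose[OF continuous_map_fst X.continuous_map_lyapunov, unfolded o_def])
  then have "closedin ?P {p \<in> topspace ?P. g (snd p) - f (fst p) \<in> {0}}"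
    by (rule closedin_continuous_map_preimage) simp
  ultimately have "closedin ?P (?R \<inter> {p \<in> topspace ?P. g (snd p) - f (fst p) \<in> {0}})"
    by (rule closedin_Int)
  moreover have "?R \<inter> {p \<in> topspace ?P. g (snd p) - f (fst p) \<in> {0}} = {(x, y). corresponds x y}"
  proof -
    have "(x, y) \<in> ?R \<inter> {p \<in> topspace ?P. g (snd p) - f (fst p) \<in> {0}} \<longleftrightarrow> corresponds x y" for x y
    proof
      assume "corresponds x y"
      then obtain a where a: "a \<in> mboundary A" "X.link a x" "Y.link (\<phi> a) y" and "g y = f x"
        by (auto simp: corresponds_def)
      moreover have "(x, y) \<in> ?R"
        using a X.link_sym[OF a(2)] by (intro relcompI[of _ "\<phi> a"] relcompI[of _ a]) auto
      ultimately show "(x, y) \<in> ?R \<inter> {p \<in> topspace ?P. g (snd p) - f (fst p) \<in> {0}}"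
        using X.link_topspace[OF a(2)] Y.link_topspace[OF a(3)] by simp
    next
      assume "(x, y) \<in> ?R \<inter> {p \<in> topspace ?P. g (snd p) - f (fst p) \<in> {0}}"
      then obtain a where "a \<in> mboundary A" "X.link x a" "Y.link (\<phi> a) y" "g y = f x"
        by auto
      then show "corresponds x y"
        using X.link_sym unfolding corresponds_def by blast
    qed
    then show ?thesis by (simp only: set_eq_iff split_paired_All) simp
  qed
  ultimately show ?thesis by simp
qed

text \<open>Closed graph theorem for a compact target: the preimage of \<open>C\<close> is the
  projection of a closed set along \<open>Y\<close>.\<close>

lemma continuous_map_corresponds:
  assumes \<Phi>: "\<And>x. x \<in> topspace X \<Longrightarrow> corresponds x (\<Phi> x)"
  shows "continuous_map X Y \<Phi>"
  unfolding continuous_map_closedin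
proof (intro conjI allI impI)
  show "\<Phi> \<in> topspace X \<rightarrow> topspace Y"
    using \<Phi> corresponds_topspace by blast
  fix C assume C: "closedin Y C"
  have "closedin (prod_topology X Y) ({(x, y). corresponds x y} \<inter> topspace X \<times> C)"
    using C by (intro closedin_Int closedin_corresponds) (simp add: closedin_prod_Times_iff)
  then have "closedin X (fst ` ({(x, y). corresponds x y} \<inter> topspace X \<times> C))"
    using closed_map_fst[OF Y.compact] unfolding closed_map_def by blast
  moreover have "fst ` ({(x, y). corresponds x y} \<inter> topspace X \<times> C) = {x \<in> topspace X. \<Phi> x \<in> C}"
  proof (intro set_eqI iffI)
    fix x assume "x \<in> fst ` ({(x, y). corresponds x y} \<inter> topspace X \<times> C)"
    then obtain y where "corresponds x y" "y \<in> C" "x \<in> topspace X" by auto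
    then show "x \<in> {x \<in> topspace X. \<Phi> x \<in> C}"
      using corresponds_unique[OF _ \<Phi>] by auto
  next
    fix x assume "x \<in> {x \<in> topspace X. \<Phi> x \<in> C}"
    then show "x \<in> fst ` ({(x, y). corresponds x y} \<inter> topspace X \<times> C)"
      using \<Phi> by (intro image_eqI[of _ _ "(x, \<Phi> x)"]) auto
  qed
  ultimately show "closedin X {x \<in> topspace X. \<Phi> x \<in> C}" by simp
qed

lemma foliated_homeomorphism_exists: "\<exists>\<Phi>. foliated_homeomorphism X A v Y B w \<Phi>"
proof -
  obtain \<psi> where \<psi>: "boundary_data_iso Y B w g X A v f \<psi>" "\<And>x. x \<in> mboundary A \<Longrightarrow> \<psi> (\<phi> x) = x"
    "\<And>y. y \<in> mboundary B \<Longrightarrow> \<phi> (\<psi> y) = y" "\<psi> ` mboundary B = mboundary A"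
    by (rule boundary_data_iso_inverse[OF iso boundary_subset]) blast
  \<comment> \<open>With the roles exchanged the correspondence is the converse relation. Its
    existence statement will give surjectivity of \<open>\<Phi>\<close>, its uniqueness statement
    injectivity, and its monotonicity the reflection of the order.\<close>
  interpret inv: boundary_iso Y B w g X A v f \<psi>
    by unfold_locales (rule \<psi>(1))
  have inverse: "inv.corresponds y x \<longleftrightarrow> corresponds x y" for x y
  proof
    assume "corresponds x y"
    then obtain a where "a \<in> mboundary A" "X.link a x" "Y.link (\<phi> a) y" "g y = f x"
      by (auto simp: corresponds_def)
    then show "inv.corresponds y x"
      using \<psi>(2)[of a] \<phi>_boundary[of a] unfolding inv.corresponds_def by metis
  next
    assume "inv.corresponds y x"
    then obtain b where "b \<in> mboundary B" "Y.link b y" "X.link (\<psi> b) x" "f x = g y"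
      by (auto simp: inv.corresponds_def)
    then show "corresponds x y"
      using \<psi>(3)[of b] inv.\<phi>_boundary[of b] unfolding corresponds_def by metis
  qed
  have "\<forall>x\<in>topspace X. \<exists>y. corresponds x y"
    using corresponds_exists by blast
  then obtain \<Phi> where \<Phi>: "\<And>x. x \<in> topspace X \<Longrightarrow> corresponds x (\<Phi> x)"
    using bchoice by metis
  have sub: "\<Phi> x \<in> topspace Y" if "x \<in> topspace X" for x
    using corresponds_topspace(2)[OF \<Phi>[OF that]] .
  have surj: "\<Phi> ` topspace X = topspace Y"
  proof (intro equalityI subsetI)
    fix y assume "y \<in> topspace Y"
    then obtain x where x: "corresponds x y"
      using inv.corresponds_exists inverse by blast
    then have "\<Phi> x = y"
      using corresponds_unique[OF \<Phi>] corresponds_topspace(1) by blast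
    then show "y \<in> \<Phi> ` topspace X"
      using corresponds_topspace(1)[OF x] by blast
  qed (use sub in blast)
  have inj: "inj_on \<Phi> (topspace X)"
  proof (rule inj_onI)
    fix x x' assume x: "x \<in> topspace X" "x' \<in> topspace X" "\<Phi> x = \<Phi> x'"
    then show "x = x'"
      using inv.corresponds_unique[of "\<Phi> x" x x'] \<Phi>[OF x(1)] \<Phi>[OF x(2)] inverse by simp
  qed
  have homeo: "homeomorphic_map X Y \<Phi>"
    by (rule continuous_imp_homeomorphic_map[OF continuous_map_corresponds[OF \<Phi>] X.compact Y.hausdorff surj inj])
  have reach: "X.reach x x' \<longleftrightarrow> Y.reach (\<Phi> x) (\<Phi> x')" if "x \<in> topspace X" "x' \<in> topspace X" for x x'
    using corresponds_reach[OF \<Phi>[OF that(1)] \<Phi>[OF that(2)]]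
      inv.corresponds_reach[of "\<Phi> x" x "\<Phi> x'" x'] \<Phi>[OF that(1)] \<Phi>[OF that(2)] inverse by blast
  then have link: "X.link x x' \<longleftrightarrow> Y.link (\<Phi> x) (\<Phi> x')" if "x \<in> topspace X" "x' \<in> topspace X" for x x'
    using that by (simp add: linked_def)
  have leaf: "\<Phi> ` {x'. X.link x x'} = {y. Y.link (\<Phi> x) y}" if x: "x \<in> topspace X" for x
  proof (intro equalityI subsetI)
    fix y assume "y \<in> \<Phi> ` {x'. X.link x x'}"
    then obtain x' where "X.link x x'" "y = \<Phi> x'" by blast
    then show "y \<in> {y. Y.link (\<Phi> x) y}"
      using link[OF x] X.link_topspace[of x x'] by simp
  next
    fix y assume y: "y \<in> {y. Y.link (\<Phi> x) y}"
    then have "y \<in> topspace Y" using Y.link_topspace by simp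
    then obtain x' where "x' \<in> topspace X" "y = \<Phi> x'" using surj by blast
    then show "y \<in> \<Phi> ` {x'. X.link x x'}"
      using y link[OF x] by simp
  qed
  have "(`) \<Phi> ` trajectories X A v = (\<lambda>x. \<Phi> ` {x'. X.link x x'}) ` topspace X"
    unfolding X.trajectories_eq by (auto simp: image_iff)
  also have "\<dots> = (\<lambda>x. {y. Y.link (\<Phi> x) y}) ` topspace X"
    by (rule image_cong) (simp_all add: leaf)
  also have "\<dots> = (\<lambda>z. {y. Y.link z y}) ` topspace Y"
    unfolding surj[symmetric] image_image ..
  also have "\<dots> = trajectories Y B w"
    unfolding Y.trajectories_eq by (auto simp: image_iff)
  finally have "(`) \<Phi> ` trajectories X A v = trajectories Y B w" .
  then have "foliated_homeomorphism X A v Y B w \<Phi>"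
    using homeo reach by (simp add: foliated_homeomorphism_def X.trajectory_order_iff Y.trajectory_order_iff)
  then show ?thesis by blast
qed

end

text \<open>Reconstruction is read as follows: isomorphic boundary data force the foliated pairs to
  be homeomorphic. The model spaces \<open>'e\<close> and \<open>'d\<close> are independent, so
  equality of dimensions is not presupposed.\<close>

theorem theorem3p1:
  fixes X :: "'a topology" and A :: "('a, 'e::euclidean_space) chart set"
    and v :: "('a, 'e) vfield" and f :: "'a \<Rightarrow> real"
    and Y :: "'b topology" and B :: "('b, 'd::euclidean_space) chart set"
    and w :: "('b, 'd) vfield" and g :: "'b \<Rightarrow> real"
    and \<phi> :: "'a \<Rightarrow> 'b"
  assumes "smooth_manifold_with_boundary X A" "compact_space X" "connected_space X"
    and "traversing X A v" "lyapunov A v f"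
    and "smooth_manifold_with_boundary Y B" "compact_space Y" "connected_space Y"
    and "traversing Y B w" "lyapunov B w g"
    and "boundary_data_iso X A v f Y B w g \<phi>"
  shows "\<exists>\<Phi>. foliated_homeomorphism X A v Y B w \<Phi>"
proof -
  interpret X: traversed X A v f
    by (rule traversed_traversing) fact+
  interpret Y: traversed Y B w g
    by (rule traversed_traversing) fact+
  interpret boundary_iso X A v f Y B w g \<phi>
    by unfold_locales fact
  show ?thesis by (rule foliated_homeomorphism_exists)
qed

end
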